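(* Let $n$ be a positive integer. The Lie point symmetries of the equation $$u_t-u_{txx}+\frac{(n+1)(n+2)}{2}u^nu_x=\frac{n(n-1)}{2}u^{n-2}u_x^3+2n u^{n-1}u_xu_{xx}+u^n u_{xxx}$$ are (generated by) $$\mathbf{v}_1=\partial_t,\qquad \mathbf{v}_2=\partial_x,\qquad \mathbf{v}_3=n t\,\partial_t-u\,\partial_u,$$ i.e. every generator of Lie point symmetries of the equation is a linear combination, with real constant coefficients, of $\mathbf{v}_1,\mathbf{v}_2,\mathbf{v}_3$, and each of these is such a generator.
   Context: Here $u=u(t,x)$; for $n=1$ the term with coefficient $n(n-1)/2$ is absent. A Lie point symmetry of a differential equation is a local diffeomorphism of the space of variables $(t,x,u)$ that maps (smooth) solutions of the equation into solutions in a smooth way, arising as the flow of a generator $\mathbf{v}=\tau(t,x,u)\partial_t+\xi(t,x,u)\partial_x+\eta(t,x,u)\partial_u$ with smooth coefficients. Equivalently, $\mathbf{v}$ is a generator of Lie point symmetries if its third prolongation applied to the equation vanishes on the solution manifold of the equation in the jet space. *)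

theory Defs
  imports "HOL-Analysis.Analysis"
begin

fun times_cont_diff_on ::
    "nat \<Rightarrow> 'a::real_normed_vector set \<Rightarrow> ('a \<Rightarrow> 'b::real_normed_vector) \<Rightarrow> bool" where
  "times_cont_diff_on 0 S f \<longleftrightarrow> continuous_on S f"
| "times_cont_diff_on (Suc k) S f \<longleftrightarrow>
     (\<forall>p\<in>S. f differentiable (at p)) \<and>
     (\<forall>h. times_cont_diff_on k S (\<lambda>p. frechet_derivative f (at p) h))"

definition smooth_on ::
    "'a::real_normed_vector set \<Rightarrow> ('a \<Rightarrow> 'b::real_normed_vector) \<Rightarrow> bool" where
  "smooth_on S f \<longleftrightarrow> (\<forall>k. times_cont_diff_on k S f)"

text \<open>
  Jet coordinates for one dependent variable \<open>u\<close> and the independent variables \<open>t\<close>, \<open>x\<close>: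
  \<open>Du i j\<close> is the coordinate of the derivative of \<open>u\<close> taken \<open>i\<close> times with respect to \<open>t\<close> and
  \<open>j\<close> times with respect to \<open>x\<close>, so \<open>Du 0 0\<close> is \<open>u\<close> itself.  A jet assigns a value to
  every coordinate; the jet space of order \<open>k\<close> is obtained by ignoring the \<open>Du i j\<close> with
  \<open>i + j > k\<close>.  A differential function of order \<open>k\<close> is a function of jets which depends
  only on \<open>t\<close>, \<open>x\<close> and the \<open>Du i j\<close> with \<open>i + j \<le> k\<close>.
\<close>

datatype jvar = Vt | Vx | Du nat nat

type_synonym jet = "jvar \<Rightarrow> real"

definition base :: "jet \<Rightarrow> real \<times> real \<times> real" where
  "base p = (p Vt, p Vx, p (Du 0 0))"

definition pderiv_jet :: "jvar \<Rightarrow> (jet \<Rightarrow> real) \<Rightarrow> jet \<Rightarrow> real" where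
  "pderiv_jet c F p = deriv (\<lambda>s. F (p(c := s))) (p c)"

text \<open>
  \<open>total_t k F\<close> and \<open>total_x k F\<close> are the total derivatives of a differential function \<open>F\<close> of
  order at most \<open>k\<close>; the bound only serves to make the sums finite.
\<close>

definition total_t :: "nat \<Rightarrow> (jet \<Rightarrow> real) \<Rightarrow> jet \<Rightarrow> real" where
  "total_t k F p = pderiv_jet Vt F p
     + (\<Sum>(i, j) \<in> {(i, j). i + j \<le> k}. p (Du (Suc i) j) * pderiv_jet (Du i j) F p)"

definition total_x :: "nat \<Rightarrow> (jet \<Rightarrow> real) \<Rightarrow> jet \<Rightarrow> real" where
  "total_x k F p = pderiv_jet Vx F p
     + (\<Sum>(i, j) \<in> {(i, j). i + j \<le> k}. p (Du i (Suc j)) * pderiv_jet (Du i j) F p)"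

text \<open>
  The vector field \<open>\<tau> \<partial>\<^sub>t + \<xi> \<partial>\<^sub>x + \<eta> \<partial>\<^sub>u\<close> is the map \<open>(t, x, u) \<mapsto> (\<tau>, \<xi>, \<eta>)\<close>.
\<close>

type_synonym vfield = "real \<times> real \<times> real \<Rightarrow> real \<times> real \<times> real"

definition tau :: "vfield \<Rightarrow> jet \<Rightarrow> real" where
  "tau v p = fst (v (base p))"

definition xi :: "vfield \<Rightarrow> jet \<Rightarrow> real" where
  "xi v p = fst (snd (v (base p)))"

definition eta :: "vfield \<Rightarrow> jet \<Rightarrow> real" where
  "eta v p = snd (snd (v (base p)))"

text \<open>
  \<open>prol_coeff v i j\<close> is the coefficient of \<open>\<partial>/\<partial>(Du i j)\<close> in the prolongation of \<open>v\<close>, by the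
  usual recursion \<open>\<eta>\<^bsup>J,s\<^esup> = D\<^sub>s \<eta>\<^bsup>J\<^esup> - u\<^bsub>J,t\<^esub> D\<^sub>s \<tau> - u\<^bsub>J,x\<^esub> D\<^sub>s \<xi>\<close> for \<open>s\<close> either \<open>t\<close> or \<open>x\<close>.
  It is a differential function of order \<open>i + j\<close>.
\<close>

fun prol_coeff :: "vfield \<Rightarrow> nat \<Rightarrow> nat \<Rightarrow> jet \<Rightarrow> real" where
  "prol_coeff v 0 0 = eta v"
| "prol_coeff v (Suc i) 0 = (\<lambda>p. total_t i (prol_coeff v i 0) p
     - p (Du (Suc i) 0) * total_t 0 (tau v) p - p (Du i 1) * total_t 0 (xi v) p)"
| "prol_coeff v i (Suc j) = (\<lambda>p. total_x (i + j) (prol_coeff v i j) p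
     - p (Du (Suc i) j) * total_x 0 (tau v) p - p (Du i (Suc j)) * total_x 0 (xi v) p)"

definition prolongation :: "nat \<Rightarrow> vfield \<Rightarrow> (jet \<Rightarrow> real) \<Rightarrow> jet \<Rightarrow> real" where
  "prolongation k v F p = tau v p * pderiv_jet Vt F p + xi v p * pderiv_jet Vx F p
     + (\<Sum>(i, j) \<in> {(i, j). i + j \<le> k}. prol_coeff v i j p * pderiv_jet (Du i j) F p)"

text \<open>
  \<open>v\<close>, defined on the open set \<open>S\<close> of the space of variables \<open>(t, x, u)\<close>, generates Lie point
  symmetries of the equation \<open>F = 0\<close> of order \<open>k\<close>.  Values of \<open>v\<close> outside \<open>S\<close> are irrelevant.
\<close>

definition lie_point_symmetry_generator ::
    "nat \<Rightarrow> (jet \<Rightarrow> real) \<Rightarrow> (real \<times> real \<times> real) set \<Rightarrow> vfield \<Rightarrow> bool" where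
  "lie_point_symmetry_generator k F S v \<longleftrightarrow>
     smooth_on S v \<and> (\<forall>p. base p \<in> S \<longrightarrow> F p = 0 \<longrightarrow> prolongation k v F p = 0)"

text \<open>
  Left-hand side minus right-hand side of the equation.  For \<open>n = 1\<close> the truncated exponent
  \<open>n - 2\<close> is harmless, since the coefficient of that term is zero.
\<close>

definition equation :: "nat \<Rightarrow> jet \<Rightarrow> real" where
  "equation n p =
    (let u = p (Du 0 0); u_t = p (Du 1 0); u_x = p (Du 0 1); u_xx = p (Du 0 2);
         u_txx = p (Du 1 2); u_xxx = p (Du 0 3)
     in (u_t - u_txx + (real n + 1) * (real n + 2) / 2 * u ^ n * u_x)
        - (real n * (real n - 1) / 2 * u ^ (n - 2) * u_x ^ 3
           + 2 * real n * u ^ (n - 1) * u_x * u_xx + u ^ n * u_xxx))"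

definition v1 :: vfield where
  "v1 = (\<lambda>(t, x, u). (1, 0, 0))"

definition v2 :: vfield where
  "v2 = (\<lambda>(t, x, u). (0, 1, 0))"

definition v3 :: "nat \<Rightarrow> vfield" where
  "v3 n = (\<lambda>(t, x, u). (real n * t, 0, - u))"

end

theory Submission
  imports Defs
begin

text \<open>
  Invariance is a polynomial identity in the jet coordinates once \<open>u\<^bsub>txx\<^esub>\<close> has been eliminated.  The
  coordinate \<open>u\<^bsub>ttx\<^esub>\<close> enters only through \<open>D\<^sub>x \<tau>\<close>, so \<open>\<tau>\<close> depends on \<open>t\<close> alone.  Further coefficients give
  \<open>\<xi>\<^sub>u = 0\<close>, \<open>\<eta>\<^bsub>uu\<^esub> = 0\<close>, \<open>2 \<eta>\<^bsub>ux\<^esub> = \<xi>\<^bsub>xx\<^esub>\<close>, \<open>\<eta>\<^bsub>uxx\<^esub> = 2 \<xi>\<^sub>x\<close> and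
  \<open>n u\<^bsup>n-1\<^esup> \<eta> = \<xi>\<^sub>t + u\<^sup>n (\<xi>\<^sub>x - \<tau>\<^sub>t)\<close>.  Inserting the \<open>x\<close>-derivative of the last equation into the coefficient of
  \<open>u\<^bsub>xx\<^esub>\<close> yields \<open>2 \<eta>\<^bsub>tu\<^esub> + u\<^sup>n \<xi>\<^bsub>xx\<^esub> = 0\<close>, and differentiating by \<open>u\<close> forces \<open>\<xi>\<^bsub>xx\<^esub> = 0\<close>; then \<open>\<xi>\<^sub>x = 0\<close> and
  \<open>\<eta>\<^sub>u\<close> is constant.  The coefficient of \<open>u\<^sub>x\<close> is \<open>((n+1)(n+2)/2 - 1) \<xi>\<^sub>t\<close>, so \<open>\<xi>\<close> is constant and
  \<open>n \<eta> = - u \<tau>\<^sub>t\<close>.  Divisions by powers of \<open>u\<close> take place where \<open>u \<noteq> 0\<close>, which is dense in \<open>S\<close>.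
\<close>

subsection \<open>Directional derivatives of smooth functions\<close>

text \<open>The direction comes first so that \<open>dirderiv h\<close> is an operator that can be
  iterated. It is the operator in the recursion of \<open>times_cont_diff_on\<close>, hence
  \<open>smooth_on\<close> is closed under it.\<close>

definition dirderiv :: "'a::real_normed_vector \<Rightarrow> ('a \<Rightarrow> real) \<Rightarrow> 'a \<Rightarrow> real" where
  "dirderiv h f q = frechet_derivative f (at q) h"

lemma dirderiv_eqI: "(f has_derivative f') (at q) \<Longrightarrow> dirderiv h f q = f' h"
  unfolding dirderiv_def using frechet_derivative_at by metis

lemma has_derivative_dirderiv:
  "f differentiable (at q) \<Longrightarrow> (f has_derivative (\<lambda>h. dirderiv h f q)) (at q)"
  unfolding dirderiv_def using frechet_derivative_works by metis

lemma dirderiv_cong_open: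
  assumes "f differentiable (at q)" "open S" "q \<in> S" "\<And>r. r \<in> S \<Longrightarrow> f r = g r"
  shows "dirderiv h f q = dirderiv h g q"
  unfolding dirderiv_def using frechet_derivative_transform_within_open[OF assms] by simp

lemma dirderiv_zero_on_open:
  assumes "open S" "q \<in> S" "\<And>r. r \<in> S \<Longrightarrow> f r = 0"
  shows "dirderiv h f q = 0"
proof -
  have "dirderiv h (\<lambda>r. 0) q = dirderiv h f q"
    using assms by (intro dirderiv_cong_open[of _ q S]) auto
  then show ?thesis by (simp add: dirderiv_def)
qed

lemma dirderiv_const [simp]: "dirderiv h (\<lambda>q. c) = (\<lambda>q. 0)"
  by (rule ext) (simp add: dirderiv_def)

lemma dirderiv_add:
  "f differentiable (at q) \<Longrightarrow> g differentiable (at q) \<Longrightarrow>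
    dirderiv h (\<lambda>q. f q + g q) q = dirderiv h f q + dirderiv h g q"
  by (rule dirderiv_eqI has_derivative_add has_derivative_dirderiv | assumption)+

lemma dirderiv_diff:
  "f differentiable (at q) \<Longrightarrow> g differentiable (at q) \<Longrightarrow>
    dirderiv h (\<lambda>q. f q - g q) q = dirderiv h f q - dirderiv h g q"
  by (rule dirderiv_eqI has_derivative_diff has_derivative_dirderiv | assumption)+

lemma dirderiv_mult:
  "f differentiable (at q) \<Longrightarrow> g differentiable (at q) \<Longrightarrow>
    dirderiv h (\<lambda>q. f q * g q) q = f q * dirderiv h g q + dirderiv h f q * g q"
  by (rule dirderiv_eqI has_derivative_mult has_derivative_dirderiv | assumption)+

text \<open>Chain rule along an affine line; it carries Frechet derivatives over to the mean value
  theorem and to \<open>pderiv_jet\<close>.\<close>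

lemma DERIV_along_line:
  assumes "f differentiable (at (q + s *\<^sub>R h))"
  shows "((\<lambda>r. f (q + r *\<^sub>R h)) has_real_derivative dirderiv h f (q + s *\<^sub>R h)) (at s)"
proof -
  let ?f' = "\<lambda>h'. dirderiv h' f (q + s *\<^sub>R h)"
  have d: "(f has_derivative ?f') (at (q + s *\<^sub>R h))"
    by (rule has_derivative_dirderiv[OF assms])
  have l: "((\<lambda>r. q + r *\<^sub>R h) has_derivative (\<lambda>r. r *\<^sub>R h)) (at s)"
    by (auto intro!: derivative_eq_intros)
  have "((\<lambda>r. f (q + r *\<^sub>R h)) has_derivative (\<lambda>r. ?f' (r *\<^sub>R h))) (at s)"
    using has_derivative_compose[OF l d] by simp
  moreover have "(\<lambda>r. ?f' (r *\<^sub>R h)) = (*) (?f' h)"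
    using linear_scale[OF has_derivative_linear[OF d]] by (auto simp: mult.commute)
  ultimately show ?thesis by (simp add: has_field_derivative_def)
qed

lemma smooth_on_differentiable: "smooth_on S f \<Longrightarrow> q \<in> S \<Longrightarrow> f differentiable (at q)"
  unfolding smooth_on_def by (metis times_cont_diff_on.simps(2))

lemma smooth_on_continuous: "smooth_on S f \<Longrightarrow> continuous_on S f"
  unfolding smooth_on_def by (metis times_cont_diff_on.simps(1))

lemma smooth_on_dirderiv: "smooth_on S f \<Longrightarrow> smooth_on S (dirderiv h f)"
  unfolding smooth_on_def dirderiv_def by (metis times_cont_diff_on.simps(2))

text \<open>Near a point of an open set both functions agree, so their Frechet derivatives agree
  there and induction applies. This allows a derivative to be replaced by a formula known on
  \<open>S\<close> only.\<close>

lemma times_cont_diff_on_cong: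
  assumes "open S" "\<And>q. q \<in> S \<Longrightarrow> f q = g q" "times_cont_diff_on k S f"
  shows "times_cont_diff_on k S g"
  using assms(2,3)
proof (induction k arbitrary: f g)
  case 0
  then show ?case using continuous_on_cong by (metis times_cont_diff_on.simps(1))
next
  case (Suc k)
  have fd: "f differentiable (at q)" if "q \<in> S" for q using Suc.prems that by simp
  have "g differentiable (at q)" if "q \<in> S" for q
    using fd[OF that] Suc.prems(1) \<open>open S\<close> that has_derivative_transform_within_open
    unfolding differentiable_def by metis
  moreover have "times_cont_diff_on k S (\<lambda>q. frechet_derivative g (at q) h)" for h
  proof (rule Suc.IH)
    show "times_cont_diff_on k S (\<lambda>q. frechet_derivative f (at q) h)" using Suc.prems by simp
    show "frechet_derivative f (at q) h = frechet_derivative g (at q) h" if "q \<in> S" for q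
      using frechet_derivative_transform_within_open[OF fd[OF that] \<open>open S\<close> that] Suc.prems(1)
      by metis
  qed
  ultimately show ?case by simp
qed

text \<open>A bounded linear map commutes with differentiation, so the induction hypothesis applies
  to the directional derivatives of \<open>f\<close>. With \<open>fst\<close> and \<open>snd\<close>
  this yields smooth components of a vector field.\<close>

lemma smooth_on_bounded_linear_compose:
  assumes "bounded_linear L" "open S" "smooth_on S f"
  shows "smooth_on S (\<lambda>q. L (f q))"
proof -
  have "times_cont_diff_on k S (\<lambda>q. L (f q))" if "times_cont_diff_on k S f" for k
    using that
  proof (induction k arbitrary: f)
    case 0
    then show ?case using bounded_linear.continuous_on[OF assms(1)] by simp
  next
    case (Suc k)
    have der: "((\<lambda>q. L (f q)) has_derivative (\<lambda>h. L (frechet_derivative f (at q) h))) (at q)"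
      if "q \<in> S" for q
      using Suc.prems that frechet_derivative_works
      by (intro bounded_linear.has_derivative[OF assms(1)]) auto
    have "times_cont_diff_on k S (\<lambda>q. frechet_derivative (\<lambda>q. L (f q)) (at q) h)" for h
    proof (rule times_cont_diff_on_cong[OF \<open>open S\<close>])
      show "times_cont_diff_on k S (\<lambda>q. L (frechet_derivative f (at q) h))"
        using Suc by simp
      show "L (frechet_derivative f (at q) h) = frechet_derivative (\<lambda>q. L (f q)) (at q) h"
        if "q \<in> S" for q
        using frechet_derivative_at[OF der[OF that]] by metis
    qed
    moreover have "(\<lambda>q. L (f q)) differentiable (at q)" if "q \<in> S" for q
      by (rule differentiableI[OF der[OF that]])
    ultimately show ?case by simp
  qed
  then show ?thesis using assms(3) by (simp add: smooth_on_def)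
qed

lemma smooth_on_const: "smooth_on S (\<lambda>q. c)"
proof -
  have "times_cont_diff_on k S (\<lambda>q. c)" for k
    by (induction k arbitrary: c) auto
  then show ?thesis by (simp add: smooth_on_def)
qed

lemma smooth_on_bounded_linear:
  assumes "bounded_linear L"
  shows "smooth_on S L"
proof -
  have "times_cont_diff_on k S L" for k
  proof (cases k)
    case 0
    then show ?thesis using assms linear_continuous_on by auto
  next
    case (Suc j)
    have "frechet_derivative L (at q) = L" for q
      using frechet_derivative_at[OF bounded_linear.has_derivative[OF assms has_derivative_ident]] by simp
    then show ?thesis
      using Suc assms smooth_on_const[of S] bounded_linear_imp_differentiable by (auto simp: smooth_on_def)
  qed
  then show ?thesis by (simp add: smooth_on_def)
qed

section \<open>Symmetry of second directional derivatives\<close>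

text \<open>The mean value theorem is applied twice: in direction \<open>h\<close> to the first
  difference of \<open>f\<close> in direction \<open>k\<close>, then in direction \<open>k\<close>
  to \<open>dirderiv h f\<close>.\<close>

lemma second_difference_mean_value:
  fixes f :: "'a::real_normed_vector \<Rightarrow> real"
  assumes f: "smooth_on (ball q d) f" and s: "s > 0" "s * (norm h + norm k) < d"
  obtains r1 r2 where "0 < r1" "r1 < s" "0 < r2" "r2 < s"
    "f (q + s *\<^sub>R h + s *\<^sub>R k) - f (q + s *\<^sub>R h) - f (q + s *\<^sub>R k) + f q
      = s\<^sup>2 * dirderiv k (dirderiv h f) (q + r1 *\<^sub>R h + r2 *\<^sub>R k)"
proof -
  have mem: "q + a *\<^sub>R h + b *\<^sub>R k \<in> ball q d" if "0 \<le> a" "a \<le> s" "0 \<le> b" "b \<le> s" for a b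
  proof -
    have "norm (a *\<^sub>R h + b *\<^sub>R k) \<le> a * norm h + b * norm k"
      using norm_triangle_ineq[of "a *\<^sub>R h" "b *\<^sub>R k"] that by simp
    also have "\<dots> \<le> s * norm h + s * norm k"
      using that by (intro add_mono mult_right_mono) auto
    finally show ?thesis
      using s norm_minus_cancel[of "a *\<^sub>R h + b *\<^sub>R k"] by (simp add: dist_norm distrib_left)
  qed
  define g where "g r = f (q + s *\<^sub>R k + r *\<^sub>R h) - f (q + r *\<^sub>R h)" for r
  have "DERIV g r :> dirderiv h f (q + s *\<^sub>R k + r *\<^sub>R h) - dirderiv h f (q + r *\<^sub>R h)"
    if "0 \<le> r" "r \<le> s" for r
    unfolding g_def
    using that mem[of r 0] mem[of r s] s(1)
    by (intro DERIV_diff DERIV_along_line smooth_on_differentiable[OF f]) (auto simp: algebra_simps)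
  from MVT2[OF s(1) this] obtain r1 where r1: "0 < r1" "r1 < s"
    "g s - g 0 = (s - 0) * (dirderiv h f (q + s *\<^sub>R k + r1 *\<^sub>R h) - dirderiv h f (q + r1 *\<^sub>R h))" by blast
  have "DERIV (\<lambda>r. dirderiv h f (q + r1 *\<^sub>R h + r *\<^sub>R k)) r
      :> dirderiv k (dirderiv h f) (q + r1 *\<^sub>R h + r *\<^sub>R k)" if "0 \<le> r" "r \<le> s" for r
    using that mem[of r1 r] r1
    by (intro DERIV_along_line smooth_on_differentiable[OF smooth_on_dirderiv[OF f]]) auto
  from MVT2[OF s(1) this] obtain r2 where r2: "0 < r2" "r2 < s"
    "dirderiv h f (q + r1 *\<^sub>R h + s *\<^sub>R k) - dirderiv h f (q + r1 *\<^sub>R h + 0 *\<^sub>R k)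
      = (s - 0) * dirderiv k (dirderiv h f) (q + r1 *\<^sub>R h + r2 *\<^sub>R k)" by blast
  show ?thesis
  proof (rule that[OF r1(1,2) r2(1,2)])
    have "g s - g 0 = s * (s * dirderiv k (dirderiv h f) (q + r1 *\<^sub>R h + r2 *\<^sub>R k))"
      using r1(3) r2(3) by (simp add: add_ac)
    then show "f (q + s *\<^sub>R h + s *\<^sub>R k) - f (q + s *\<^sub>R h) - f (q + s *\<^sub>R k) + f q
      = s\<^sup>2 * dirderiv k (dirderiv h f) (q + r1 *\<^sub>R h + r2 *\<^sub>R k)"
      by (simp add: g_def power2_eq_square add_ac)
  qed
qed

lemma smooth_on_subset: "smooth_on S f \<Longrightarrow> T \<subseteq> S \<Longrightarrow> smooth_on T f"
proof -
  have "times_cont_diff_on k S f \<Longrightarrow> T \<subseteq> S \<Longrightarrow> times_cont_diff_on k T f" for k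
    by (induction k arbitrary: f) (auto intro: continuous_on_subset)
  then show "smooth_on S f \<Longrightarrow> T \<subseteq> S \<Longrightarrow> smooth_on T f" by (auto simp: smooth_on_def)
qed

text \<open>The second difference is symmetric in \<open>h\<close> and \<open>k\<close>, so the two
  mixed derivatives agree when taken at suitable points close to \<open>q\<close>; their continuity
  at \<open>q\<close> does the rest.\<close>

theorem dirderiv_commute:
  fixes f :: "'a::real_normed_vector \<Rightarrow> real"
  assumes f: "smooth_on S f" and "open S" "q \<in> S"
  shows "dirderiv h (dirderiv k f) q = dirderiv k (dirderiv h f) q"
proof -
  let ?F = "dirderiv h (dirderiv k f)" and ?G = "dirderiv k (dirderiv h f)"
  have "\<bar>?F q - ?G q\<bar> \<le> 2 * e" if "e > 0" for e
  proof -
    have c: "continuous (at q) ?F" "continuous (at q) ?G"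
      using smooth_on_continuous[OF smooth_on_dirderiv[OF smooth_on_dirderiv[OF f]]]
        continuous_on_eq_continuous_at[OF \<open>open S\<close>] \<open>q \<in> S\<close> by blast+
    from c(1) obtain d1 where d1: "d1 > 0" "\<And>y. dist y q < d1 \<Longrightarrow> dist (?F y) (?F q) < e"
      using \<open>e > 0\<close> unfolding continuous_at_eps_delta by blast
    from c(2) obtain d2 where d2: "d2 > 0" "\<And>y. dist y q < d2 \<Longrightarrow> dist (?G y) (?G q) < e"
      using \<open>e > 0\<close> unfolding continuous_at_eps_delta by blast
    obtain d0 where d0: "d0 > 0" "ball q d0 \<subseteq> S" using assms openE by blast
    define d where "d = min d0 (min d1 d2)"
    have d: "d > 0" using d0 d1 d2 by (simp add: d_def)
    have fb: "smooth_on (ball q d) f"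
      by (rule smooth_on_subset[OF f]) (use d0 in \<open>auto simp: d_def\<close>)
    \<comment> \<open>The summand 1 keeps \<open>m\<close> positive even if \<open>h\<close> and
      \<open>k\<close> vanish; \<open>s * m = d / 2\<close> keeps all points used within
      \<open>d\<close> of \<open>q\<close>.\<close>
    define m where "m = norm h + norm k + 1"
    define s where "s = d / (2 * m)"
    have m: "m > 0" unfolding m_def by (smt (verit) norm_ge_zero)
    have s: "s > 0" using d m by (simp add: s_def)
    have "s * m = d / 2" using m by (simp add: s_def)
    then have sd: "s * (norm h + norm k) < d" "s * (norm k + norm h) < d"
      using s d by (auto simp: m_def distrib_left)
    have near: "dist (q + a *\<^sub>R h + b *\<^sub>R k) q < d" if "0 < a" "a < s" "0 < b" "b < s" for a b
    proof -
      have "norm (a *\<^sub>R h + b *\<^sub>R k) \<le> a * norm h + b * norm k"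
        using norm_triangle_ineq[of "a *\<^sub>R h" "b *\<^sub>R k"] that by simp
      also have "\<dots> \<le> s * norm h + s * norm k"
        using that by (intro add_mono mult_right_mono) auto
      finally show ?thesis using sd by (simp add: dist_norm distrib_left)
    qed
    obtain a b where ab: "0 < a" "a < s" "0 < b" "b < s"
      "f (q + s *\<^sub>R h + s *\<^sub>R k) - f (q + s *\<^sub>R h) - f (q + s *\<^sub>R k) + f q
        = s\<^sup>2 * ?G (q + a *\<^sub>R h + b *\<^sub>R k)"
      by (rule second_difference_mean_value[OF fb s sd(1)])
    obtain a' b' where ab': "0 < a'" "a' < s" "0 < b'" "b' < s"
      "f (q + s *\<^sub>R k + s *\<^sub>R h) - f (q + s *\<^sub>R k) - f (q + s *\<^sub>R h) + f q
        = s\<^sup>2 * ?F (q + a' *\<^sub>R k + b' *\<^sub>R h)"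
      by (rule second_difference_mean_value[OF fb s sd(2)])
    have sw: "q + s *\<^sub>R k + s *\<^sub>R h = q + s *\<^sub>R h + s *\<^sub>R k" by (simp add: add_ac)
    have "s\<^sup>2 * ?F (q + a' *\<^sub>R k + b' *\<^sub>R h) = s\<^sup>2 * ?G (q + a *\<^sub>R h + b *\<^sub>R k)"
      using ab(5) ab'(5) unfolding sw by linarith
    then have "?F (q + b' *\<^sub>R h + a' *\<^sub>R k) = ?G (q + a *\<^sub>R h + b *\<^sub>R k)"
      using s by (simp add: add_ac)
    moreover have "dist (?F (q + b' *\<^sub>R h + a' *\<^sub>R k)) (?F q) < e"
      using near[of b' a'] ab' by (intro d1) (auto simp: d_def)
    moreover have "dist (?G (q + a *\<^sub>R h + b *\<^sub>R k)) (?G q) < e"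
      using near[of a b] ab by (intro d2) (auto simp: d_def)
    ultimately show ?thesis by (simp add: dist_real_def)
  qed
  then have "\<bar>?F q - ?G q\<bar> \<le> e" if "e > 0" for e
    using that by (metis field_sum_of_halves half_gt_zero mult_2)
  then show ?thesis by (metis abs_le_zero_iff dense_ge eq_iff_diff_eq_0)
qed

subsection \<open>Total derivatives\<close>

definition eT :: "real \<times> real \<times> real" where "eT = (1, 0, 0)"
definition eX :: "real \<times> real \<times> real" where "eX = (0, 1, 0)"
definition eU :: "real \<times> real \<times> real" where "eU = (0, 0, 1)"

abbreviation pd_t ("\<partial>\<^sub>t") where "\<partial>\<^sub>t \<equiv> dirderiv eT"
abbreviation pd_x ("\<partial>\<^sub>x") where "\<partial>\<^sub>x \<equiv> dirderiv eX"
abbreviation pd_u ("\<partial>\<^sub>u") where "\<partial>\<^sub>u \<equiv> dirderiv eU"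

lemma unit_vector_components [simp]:
  "fst eT = 1" "fst (snd eT) = 0" "snd (snd eT) = 0"
  "fst eX = 0" "fst (snd eX) = 1" "snd (snd eX) = 0"
  "fst eU = 0" "fst (snd eU) = 0" "snd (snd eU) = 1"
  by (simp_all add: eT_def eX_def eU_def)

text \<open>Differentiability in each single coordinate is bundled with the value, because sums and
  products of \<open>deriv\<close> need it. As a relation it lets resolution synthesise
  \<open>F'\<close>. Only x is covered: in the coefficients needed, the t-derivative comes first and
  acts on functions of \<open>base p\<close>.\<close>

definition has_total_x ::
    "nat \<Rightarrow> (real \<times> real \<times> real) set \<Rightarrow> (jet \<Rightarrow> real) \<Rightarrow> (jet \<Rightarrow> real) \<Rightarrow> bool" where
  "has_total_x k S F F' \<longleftrightarrow> (\<forall>p. base p \<in> S \<longrightarrow>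
     (\<forall>c. (\<lambda>s. F (p(c := s))) field_differentiable (at (p c))) \<and> total_x k F p = F' p)"

lemma has_total_xI:
  assumes "\<And>p c. base p \<in> S \<Longrightarrow> DERIV (\<lambda>s. F (p(c := s))) (p c) :> d p c"
    and "\<And>p. base p \<in> S \<Longrightarrow>
      d p Vx + (\<Sum>(i, j) \<in> {(i, j). i + j \<le> k}. p (Du i (Suc j)) * d p (Du i j)) = F' p"
  shows "has_total_x k S F F'"
proof -
  have "pderiv_jet c F p = d p c" if "base p \<in> S" for p c
    unfolding pderiv_jet_def using assms(1)[OF that] by (rule DERIV_imp_deriv)
  then show ?thesis
    unfolding has_total_x_def total_x_def field_differentiable_def
    using assms by (intro allI impI conjI) (blast, simp)
qed

lemma has_total_x_DERIV:
  "has_total_x k S F F' \<Longrightarrow> base p \<in> S \<Longrightarrow>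
    DERIV (\<lambda>s. F (p(c := s))) (p c) :> pderiv_jet c F p"
  unfolding has_total_x_def pderiv_jet_def by (simp add: DERIV_deriv_iff_field_differentiable)

lemma has_total_xD: "has_total_x k S F F' \<Longrightarrow> base p \<in> S \<Longrightarrow> total_x k F p = F' p"
  by (simp add: has_total_x_def)

text \<open>Separates the synthesis of a derivative from its simplification: \<open>F'\<close> may
  stay schematic until the rules have processed \<open>F\<close>.\<close>

lemma has_total_x_trans:
  "has_total_x k S F F' \<Longrightarrow> (\<And>p. base p \<in> S \<Longrightarrow> F' p = F'' p) \<Longrightarrow> has_total_x k S F F''"
  by (simp add: has_total_x_def)

lemma finite_jet_index [simp]: "finite {(i::nat, j::nat). i + j \<le> k}"
  by (rule finite_subset[of _ "{..k} \<times> {..k}"]) auto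

lemma has_total_x_const: "has_total_x k S (\<lambda>p. a) (\<lambda>p. 0)"
  by (rule has_total_xI[where d = "\<lambda>p c. 0"]) auto

lemma has_total_x_coord:
  assumes "i + j \<le> k"
  shows "has_total_x k S (\<lambda>p. p (Du i j)) (\<lambda>p. p (Du i (Suc j)))"
proof (rule has_total_xI[where d = "\<lambda>p c. if c = Du i j then 1 else 0"])
  show "DERIV (\<lambda>s. (p(c := s)) (Du i j)) (p c) :> (if c = Du i j then 1 else 0)" for p c
    by auto
  fix p :: jet
  have "(\<Sum>(i', j') \<in> {(i, j). i + j \<le> k}.
      p (Du i' (Suc j')) * (if Du i' j' = Du i j then 1 else 0))
    = (\<Sum>z \<in> {(i, j). i + j \<le> k}. if z = (i, j) then p (Du i (Suc j)) else 0)"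
    by (rule sum.cong) (auto split: if_split_asm)
  then show "(if Vx = Du i j then 1 else 0) + (\<Sum>(i', j') \<in> {(i, j). i + j \<le> k}.
      p (Du i' (Suc j')) * (if Du i' j' = Du i j then 1 else 0)) = p (Du i (Suc j))"
    using assms by simp
qed

lemma has_total_x_add:
  assumes "has_total_x k S F F'" "has_total_x k S G G'"
  shows "has_total_x k S (\<lambda>p. F p + G p) (\<lambda>p. F' p + G' p)"
proof (rule has_total_xI[where d = "\<lambda>p c. pderiv_jet c F p + pderiv_jet c G p"])
  fix p assume "base p \<in> S"
  note D = has_total_xD[OF assms(1) this] has_total_xD[OF assms(2) this]
  show "DERIV (\<lambda>s. F (p(c := s)) + G (p(c := s))) (p c) :> pderiv_jet c F p + pderiv_jet c G p" for c
    using assms[THEN has_total_x_DERIV, OF \<open>base p \<in> S\<close>] by (intro DERIV_add)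
  show "pderiv_jet Vx F p + pderiv_jet Vx G p + (\<Sum>(i, j) \<in> {(i, j). i + j \<le> k}.
      p (Du i (Suc j)) * (pderiv_jet (Du i j) F p + pderiv_jet (Du i j) G p)) = F' p + G' p"
    unfolding D[symmetric] total_x_def
    by (simp add: case_prod_unfold distrib_left sum.distrib)
qed

lemma has_total_x_mult:
  assumes "has_total_x k S F F'" "has_total_x k S G G'"
  shows "has_total_x k S (\<lambda>p. F p * G p) (\<lambda>p. F' p * G p + F p * G' p)"
proof (rule has_total_xI[where d = "\<lambda>p c. pderiv_jet c F p * G p + pderiv_jet c G p * F p"])
  fix p assume "base p \<in> S"
  note D = has_total_xD[OF assms(1) this] has_total_xD[OF assms(2) this]
  show "DERIV (\<lambda>s. F (p(c := s)) * G (p(c := s))) (p c)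
      :> pderiv_jet c F p * G p + pderiv_jet c G p * F p" for c
    using DERIV_mult[OF assms[THEN has_total_x_DERIV, OF \<open>base p \<in> S\<close>]] by simp
  show "pderiv_jet Vx F p * G p + pderiv_jet Vx G p * F p + (\<Sum>(i, j) \<in> {(i, j). i + j \<le> k}.
      p (Du i (Suc j)) * (pderiv_jet (Du i j) F p * G p + pderiv_jet (Du i j) G p * F p))
    = F' p * G p + F p * G' p"
    unfolding D[symmetric] total_x_def
    by (simp add: case_prod_unfold algebra_simps sum.distrib sum_distrib_left)
qed

lemma has_total_x_diff:
  assumes "has_total_x k S F F'" "has_total_x k S G G'"
  shows "has_total_x k S (\<lambda>p. F p - G p) (\<lambda>p. F' p - G' p)"
  using has_total_x_add[OF assms(1) has_total_x_mult[OF has_total_x_const[of k S "-1"] assms(2)]]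
  by simp

text \<open>Changing t, x or u moves \<open>base p\<close> along a coordinate line; changing any
  other jet coordinate leaves it fixed.\<close>

lemma DERIV_base:
  assumes "g differentiable (at (base p))"
  shows "DERIV (\<lambda>s. g (base (p(c := s)))) (p c)
    :> (if c = Vt then \<partial>\<^sub>t g (base p) else if c = Vx then \<partial>\<^sub>x g (base p)
        else if c = Du 0 0 then \<partial>\<^sub>u g (base p) else 0)"
proof -
  have line: "DERIV (\<lambda>s. g (base p + (s - a) *\<^sub>R h)) a :> dirderiv h g (base p)" for h a
  proof -
    have "DERIV (\<lambda>r. g ((base p - a *\<^sub>R h) + r *\<^sub>R h)) a
        :> dirderiv h g ((base p - a *\<^sub>R h) + a *\<^sub>R h)"
      by (rule DERIV_along_line) (simp add: assms)
    moreover have "(base p - a *\<^sub>R h) + r *\<^sub>R h = base p + (r - a) *\<^sub>R h" for r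
      by (simp add: algebra_simps)
    ultimately show ?thesis by simp
  qed
  consider "c = Vt" | "c = Vx" | "c = Du 0 0" | "c \<notin> {Vt, Vx, Du 0 0}" by blast
  then show ?thesis
  proof cases
    case 1
    then have "base (p(c := s)) = base p + (s - p c) *\<^sub>R eT" for s by (simp add: base_def eT_def)
    then show ?thesis using line[where h = eT] 1 by simp
  next
    case 2
    then have "base (p(c := s)) = base p + (s - p c) *\<^sub>R eX" for s by (simp add: base_def eX_def)
    then show ?thesis using line[where h = eX] 2 by simp
  next
    case 3
    then have "base (p(c := s)) = base p + (s - p c) *\<^sub>R eU" for s by (simp add: base_def eU_def)
    then show ?thesis using line[where h = eU] 3 by simp
  next
    case 4
    then have "base (p(c := s)) = base p" for s by (auto simp: base_def)
    then show ?thesis using 4 by simp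
  qed
qed

section \<open>Iterated total derivatives of functions of t, x, u\<close>

definition DT :: "(real \<times> real \<times> real \<Rightarrow> real) \<Rightarrow> jet \<Rightarrow> real" where
  "DT g p = \<partial>\<^sub>t g (base p) + p (Du 1 0) * \<partial>\<^sub>u g (base p)"

definition DX :: "(real \<times> real \<times> real \<Rightarrow> real) \<Rightarrow> jet \<Rightarrow> real" where
  "DX g p = \<partial>\<^sub>x g (base p) + p (Du 0 1) * \<partial>\<^sub>u g (base p)"

text \<open>This and the next three are the total derivatives xx, xxx, tx and txx of
  \<open>g\<close>, expanded by the Leibniz rule from g_x + u_x g_u and g_t + u_t g_u. Written
  through lower operators on partial derivatives, they carry no order bound.\<close>

definition DXX :: "(real \<times> real \<times> real \<Rightarrow> real) \<Rightarrow> jet \<Rightarrow> real" where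
  "DXX g p = DX (\<partial>\<^sub>x g) p + p (Du 0 2) * \<partial>\<^sub>u g (base p)
     + p (Du 0 1) * DX (\<partial>\<^sub>u g) p"

definition DXXX :: "(real \<times> real \<times> real \<Rightarrow> real) \<Rightarrow> jet \<Rightarrow> real" where
  "DXXX g p = DXX (\<partial>\<^sub>x g) p + p (Du 0 3) * \<partial>\<^sub>u g (base p)
     + 2 * p (Du 0 2) * DX (\<partial>\<^sub>u g) p + p (Du 0 1) * DXX (\<partial>\<^sub>u g) p"

definition DTX :: "(real \<times> real \<times> real \<Rightarrow> real) \<Rightarrow> jet \<Rightarrow> real" where
  "DTX g p = DX (\<partial>\<^sub>t g) p + p (Du 1 1) * \<partial>\<^sub>u g (base p)
     + p (Du 1 0) * DX (\<partial>\<^sub>u g) p"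

definition DTXX :: "(real \<times> real \<times> real \<Rightarrow> real) \<Rightarrow> jet \<Rightarrow> real" where
  "DTXX g p = DXX (\<partial>\<^sub>t g) p + p (Du 1 2) * \<partial>\<^sub>u g (base p)
     + 2 * p (Du 1 1) * DX (\<partial>\<^sub>u g) p + p (Du 1 0) * DXX (\<partial>\<^sub>u g) p"

lemma sum_only_Du00:
  "(\<Sum>(i, j) \<in> {(i, j). i + j \<le> k}. (f i j :: real) *
     (if Du i j = Vt then a else if Du i j = Vx then b else if Du i j = Du 0 0 then d else 0))
   = f 0 0 * d"
proof -
  have "(\<Sum>(i, j) \<in> {(i, j). i + j \<le> k}. f i j *
      (if Du i j = Vt then a else if Du i j = Vx then b else if Du i j = Du 0 0 then d else 0))
    = (\<Sum>z \<in> {(i, j). i + j \<le> k}. if z = (0, 0) then f 0 0 * d else 0)"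
    by (rule sum.cong) (auto split: if_split_asm)
  then show ?thesis by simp
qed

lemma has_total_x_base:
  assumes "smooth_on S g"
  shows "has_total_x k S (\<lambda>p. g (base p)) (DX g)"
proof (rule has_total_xI[OF DERIV_base[OF smooth_on_differentiable[OF assms]]])
  show "(if Vx = Vt then \<partial>\<^sub>t g (base p) else if Vx = Vx then \<partial>\<^sub>x g (base p)
      else if Vx = Du 0 0 then \<partial>\<^sub>u g (base p) else 0)
    + (\<Sum>(i, j)\<in>{(i, j). i + j \<le> k}. p (Du i (Suc j)) *
       (if Du i j = Vt then \<partial>\<^sub>t g (base p) else if Du i j = Vx then \<partial>\<^sub>x g (base p)
        else if Du i j = Du 0 0 then \<partial>\<^sub>u g (base p) else 0)) = DX g p" for p
    unfolding sum_only_Du00 DX_def by simp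
qed

lemma total_t_base:
  assumes "smooth_on S g" "base p \<in> S"
  shows "total_t k (\<lambda>p. g (base p)) p = DT g p"
proof -
  have "pderiv_jet c (\<lambda>p. g (base p)) p =
      (if c = Vt then \<partial>\<^sub>t g (base p) else if c = Vx then \<partial>\<^sub>x g (base p)
       else if c = Du 0 0 then \<partial>\<^sub>u g (base p) else 0)" for c
    unfolding pderiv_jet_def
    by (rule DERIV_imp_deriv, rule DERIV_base[OF smooth_on_differentiable[OF assms]])
  then show ?thesis
    unfolding total_t_def DT_def by (simp only: sum_only_Du00) simp
qed

lemma eventually_base_in_open:
  assumes "open S" "base p \<in> S"
  shows "eventually (\<lambda>s. base (p(c := s)) \<in> S) (nhds (p c))"
proof -
  have "continuous_on UNIV (\<lambda>s. base (p(c := s)))"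
    unfolding base_def fun_upd_def
    by (intro continuous_on_Pair; cases "c = Vt"; cases "c = Vx"; cases "c = Du 0 0")
      (simp_all add: continuous_on_const continuous_on_id)
  then have "open ((\<lambda>s. base (p(c := s))) -` S)"
    using assms(1) by (simp add: open_vimage)
  then show ?thesis
    unfolding eventually_nhds using assms(2)
    by (intro exI[of _ "(\<lambda>s. base (p(c := s))) -` S"]) auto
qed

text \<open>The formulas for prolongation coefficients hold only over \<open>S\<close>. As
  \<open>S\<close> is open, a small change of one jet coordinate keeps \<open>base p\<close> in
  \<open>S\<close>, so both functions have the same coordinate derivatives.\<close>

lemma has_total_x_cong:
  assumes F: "has_total_x k S F F'" and S: "open S" and eq: "\<And>p. base p \<in> S \<Longrightarrow> G p = F p"
  shows "has_total_x k S G F'"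
proof (rule has_total_xI[where d = "\<lambda>p c. pderiv_jet c F p"])
  fix p assume p: "base p \<in> S"
  show "DERIV (\<lambda>s. G (p(c := s))) (p c) :> pderiv_jet c F p" for c
  proof -
    have "eventually (\<lambda>s. G (p(c := s)) = F (p(c := s))) (nhds (p c))"
      using eventually_base_in_open[OF S p] by (rule eventually_mono) (rule eq)
    then show ?thesis using has_total_x_DERIV[OF F p] DERIV_cong_ev by metis
  qed
  show "pderiv_jet Vx F p + (\<Sum>(i, j) \<in> {(i, j). i + j \<le> k}.
      p (Du i (Suc j)) * pderiv_jet (Du i j) F p) = F' p"
    using has_total_xD[OF F p] by (simp add: total_x_def)
qed

lemma has_total_x_coord_numeral:
  "k \<ge> 1 \<Longrightarrow> has_total_x k S (\<lambda>p. p (Du 0 1)) (\<lambda>p. p (Du 0 2))"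
  "k \<ge> 2 \<Longrightarrow> has_total_x k S (\<lambda>p. p (Du 0 2)) (\<lambda>p. p (Du 0 3))"
  "k \<ge> 1 \<Longrightarrow> has_total_x k S (\<lambda>p. p (Du 1 0)) (\<lambda>p. p (Du 1 1))"
  "k \<ge> 2 \<Longrightarrow> has_total_x k S (\<lambda>p. p (Du 1 1)) (\<lambda>p. p (Du 1 2))"
  "k \<ge> 2 \<Longrightarrow> has_total_x k S (\<lambda>p. p (Du 2 0)) (\<lambda>p. p (Du 2 1))"
  using has_total_x_coord[of 0 1 k S] has_total_x_coord[of 0 2 k S]
    has_total_x_coord[of 1 0 k S] has_total_x_coord[of 1 1 k S] has_total_x_coord[of 2 0 k S]
  by (simp_all add: numeral_2_eq_2 numeral_3_eq_3)

lemmas has_total_x_rules = has_total_x_const has_total_x_coord_numeral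
  has_total_x_add has_total_x_diff has_total_x_mult

lemma has_total_x_DX:
  assumes "smooth_on S g" "k \<ge> 1"
  shows "has_total_x k S (DX g) (DXX g)"
  unfolding DX_def
  apply (rule has_total_x_trans)
   apply (rule has_total_x_rules has_total_x_base smooth_on_dirderiv assms)+
  apply (simp add: DXX_def)
  done

lemma has_total_x_DT:
  assumes "smooth_on S g" "k \<ge> 1"
  shows "has_total_x k S (DT g) (DTX g)"
  unfolding DT_def
  apply (rule has_total_x_trans)
   apply (rule has_total_x_rules has_total_x_base smooth_on_dirderiv assms)+
  apply (simp add: DTX_def)
  done

lemma has_total_x_DXX:
  assumes "smooth_on S g" "k \<ge> 2"
  shows "has_total_x k S (DXX g) (DXXX g)"
proof -
  have k: "k \<ge> 1" using assms by simp
  show ?thesis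
  unfolding DXX_def
  apply (rule has_total_x_trans)
   apply (rule has_total_x_rules has_total_x_base has_total_x_DX smooth_on_dirderiv assms k)+
  apply (simp add: DXXX_def)
  done
qed

lemma has_total_x_DTX:
  assumes "smooth_on S g" "k \<ge> 2"
  shows "has_total_x k S (DTX g) (DTXX g)"
proof -
  have k: "k \<ge> 1" using assms by simp
  show ?thesis
  unfolding DTX_def
  apply (rule has_total_x_trans)
   apply (rule has_total_x_rules has_total_x_base has_total_x_DX smooth_on_dirderiv assms k)+
  apply (simp add: DTXX_def)
  done
qed

subsection \<open>The third prolongation\<close>

text \<open>\<open>T\<close>, \<open>X\<close>, \<open>Y\<close> stand for \<tau>, \<xi>, \<eta>.
  The field \<open>v\<close> is a separate parameter tied to them by an equation, so that
  \<open>v1\<close>, \<open>v2\<close> and \<open>v3 n\<close> can be inserted directly.\<close>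

locale point_vector_field =
  fixes S :: "(real \<times> real \<times> real) set" and T X Y :: "real \<times> real \<times> real \<Rightarrow> real"
    and v :: vfield
  assumes S: "open S" and sm: "smooth_on S T" "smooth_on S X" "smooth_on S Y"
    and v: "v = (\<lambda>q. (T q, X q, Y q))"
begin

lemma prol_coeff_00: "prol_coeff v 0 0 p = Y (base p)"
  by (simp add: eta_def v)

lemma vfield_components:
  "tau v = (\<lambda>p. T (base p))" "xi v = (\<lambda>p. X (base p))" "eta v = (\<lambda>p. Y (base p))"
  by (simp_all add: fun_eq_iff tau_def xi_def eta_def v)

lemma total_vfield_components:
  assumes "base p \<in> S"
  shows "total_t k (tau v) p = DT T p" "total_t k (xi v) p = DT X p" "total_t k (eta v) p = DT Y p"
    "total_x k (tau v) p = DX T p" "total_x k (xi v) p = DX X p" "total_x k (eta v) p = DX Y p"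
  unfolding vfield_components
  by (rule total_t_base sm assms has_total_xD[OF has_total_x_base])+

text \<open>The x-step of the recursion, with the successor as a premise so that it applies to
  numeral indices.\<close>

lemma prol_coeff_Suc:
  "k = Suc j \<Longrightarrow> prol_coeff v i k p = total_x (i + j) (prol_coeff v i j) p
     - p (Du (Suc i) j) * total_x 0 (tau v) p - p (Du i k) * total_x 0 (xi v) p"
  by simp

lemma prol_coeff_10:
  "base p \<in> S \<Longrightarrow> prol_coeff v 1 0 p = DT Y p - p (Du 1 0) * DT T p - p (Du 0 1) * DT X p"
  by (simp add: total_vfield_components)

lemma prol_coeff_01:
  "base p \<in> S \<Longrightarrow> prol_coeff v 0 1 p = DX Y p - p (Du 1 0) * DX T p - p (Du 0 1) * DX X p"
  by (simp add: total_vfield_components)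

lemmas has_total_x_all = has_total_x_rules has_total_x_base has_total_x_DT has_total_x_DX
  has_total_x_DXX has_total_x_DTX

text \<open>The pattern of all coefficients below: the formula one x-order lower is differentiated,
  then the two correction terms of the recursion raise the multiplicity of the highest terms in
  \<open>DX T\<close> and \<open>DX X\<close> by one.\<close>

lemma prol_coeff_02:
  assumes "base p \<in> S"
  shows "prol_coeff v 0 2 p = DXX Y p - p (Du 1 0) * DXX T p - 2 * p (Du 1 1) * DX T p
    - p (Du 0 1) * DXX X p - 2 * p (Du 0 2) * DX X p"
proof -
  have "has_total_x 1 S (prol_coeff v 0 1) (\<lambda>p. DXX Y p - p (Du 1 0) * DXX T p
    - p (Du 1 1) * DX T p - p (Du 0 1) * DXX X p - p (Du 0 2) * DX X p)"
    apply (rule has_total_x_cong[OF _ S prol_coeff_01])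
     apply (rule has_total_x_trans)
      apply (rule has_total_x_all sm order_refl)+
     apply simp_all
    done
  from has_total_xD[OF this assms] show ?thesis
    using prol_coeff_Suc[of 2 1 0 p]
    by (simp del: prol_coeff.simps One_nat_def
        add: Suc_eq_plus1 total_vfield_components assms)
qed

lemma prol_coeff_03:
  assumes "base p \<in> S"
  shows "prol_coeff v 0 3 p = DXXX Y p
    - p (Du 1 0) * DXXX T p - 3 * p (Du 1 1) * DXX T p - 3 * p (Du 1 2) * DX T p
    - p (Du 0 1) * DXXX X p - 3 * p (Du 0 2) * DXX X p - 3 * p (Du 0 3) * DX X p"
proof -
  have "has_total_x 2 S (prol_coeff v 0 2) (\<lambda>p. DXXX Y p
    - p (Du 1 0) * DXXX T p - 3 * p (Du 1 1) * DXX T p - 2 * p (Du 1 2) * DX T p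
    - p (Du 0 1) * DXXX X p - 3 * p (Du 0 2) * DXX X p - 2 * p (Du 0 3) * DX X p)"
    apply (rule has_total_x_cong[OF _ S prol_coeff_02])
     apply (rule has_total_x_trans)
      apply (rule has_total_x_all sm order_refl one_le_numeral)+
     apply simp_all
    done
  from has_total_xD[OF this assms] show ?thesis
    using prol_coeff_Suc[of 3 2 0 p]
    by (simp del: prol_coeff.simps One_nat_def
        add: Suc_eq_plus1 total_vfield_components assms)
qed

lemma prol_coeff_11:
  assumes "base p \<in> S"
  shows "prol_coeff v 1 1 p = DTX Y p - p (Du 1 0) * DTX T p - p (Du 1 1) * DT T p
    - p (Du 0 1) * DTX X p - p (Du 0 2) * DT X p - p (Du 2 0) * DX T p - p (Du 1 1) * DX X p"
proof -
  have "has_total_x 1 S (prol_coeff v 1 0) (\<lambda>p. DTX Y p - p (Du 1 0) * DTX T p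
    - p (Du 1 1) * DT T p - p (Du 0 1) * DTX X p - p (Du 0 2) * DT X p)"
    apply (rule has_total_x_cong[OF _ S prol_coeff_10])
     apply (rule has_total_x_trans)
      apply (rule has_total_x_all sm order_refl)+
     apply simp_all
    done
  from has_total_xD[OF this assms] show ?thesis
    using prol_coeff_Suc[of 1 0 1 p]
    by (simp del: prol_coeff.simps One_nat_def
        add: Suc_eq_plus1 total_vfield_components assms)
qed

text \<open>Of the coefficients needed, the only one that contains \<open>u_ttx\<close>, which
  occurs with the factor \<open>DX T\<close>.\<close>

lemma prol_coeff_12:
  assumes "base p \<in> S"
  shows "prol_coeff v 1 2 p = DTXX Y p
    - p (Du 1 0) * DTXX T p - 2 * p (Du 1 1) * DTX T p - p (Du 1 2) * DT T p
    - p (Du 0 1) * DTXX X p - 2 * p (Du 0 2) * DTX X p - p (Du 0 3) * DT X p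
    - p (Du 2 0) * DXX T p - 2 * p (Du 2 1) * DX T p
    - p (Du 1 1) * DXX X p - 2 * p (Du 1 2) * DX X p"
proof -
  have "has_total_x 2 S (prol_coeff v 1 1) (\<lambda>p. DTXX Y p
    - p (Du 1 0) * DTXX T p - 2 * p (Du 1 1) * DTX T p - p (Du 1 2) * DT T p
    - p (Du 0 1) * DTXX X p - 2 * p (Du 0 2) * DTX X p - p (Du 0 3) * DT X p
    - p (Du 2 0) * DXX T p - p (Du 2 1) * DX T p
    - p (Du 1 1) * DXX X p - p (Du 1 2) * DX X p)"
    apply (rule has_total_x_cong[OF _ S prol_coeff_11])
     apply (rule has_total_x_trans)
      apply (rule has_total_x_all sm order_refl one_le_numeral)+
     apply simp_all
    done
  from has_total_xD[OF this assms] show ?thesis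
    using prol_coeff_Suc[of 2 1 1 p]
    by (simp del: prol_coeff.simps One_nat_def
        add: Suc_eq_plus1 total_vfield_components assms)
qed

end

section \<open>Partial derivatives and prolongation of the equation\<close>

lemma jet_index_3: "{(i, j). i + j \<le> (3::nat)} =
  {(0,0), (0,1), (0,2), (0,3), (1,0), (1,1), (1,2), (2,0), (2,1), (3,0)}" (is "_ = ?R")
proof (rule set_eqI)
  fix z :: "nat \<times> nat"
  obtain i j where z: "z = (i, j)" by (cases z)
  have "i + j \<le> 3 \<longleftrightarrow> i = 0 \<and> j = 0 \<or> i = 0 \<and> j = 1 \<or> i = 0 \<and> j = 2 \<or> i = 0 \<and> j = 3
    \<or> i = 1 \<and> j = 0 \<or> i = 1 \<and> j = 1 \<or> i = 1 \<and> j = 2 \<or> i = 2 \<and> j = 0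
    \<or> i = 2 \<and> j = 1 \<or> i = 3 \<and> j = 0"
    by presburger
  then show "z \<in> {(i, j). i + j \<le> 3} \<longleftrightarrow> z \<in> ?R" unfolding z by simp
qed

text \<open>Truncated exponents are harmless: whenever truncation takes effect, a factor such as
  \<open>real n - 1\<close> or \<open>real (n - 2)\<close> in the same term is zero.\<close>

lemma pderiv_jet_equation:
  "pderiv_jet Vt (equation n) p = 0"
  "pderiv_jet Vx (equation n) p = 0"
  "pderiv_jet (Du 0 0) (equation n) p
    = (real n + 1) * (real n + 2) / 2 * (real n * p (Du 0 0) ^ (n - 1)) * p (Du 0 1)
      - real n * (real n - 1) / 2 * (real (n - 2) * p (Du 0 0) ^ (n - 3)) * p (Du 0 1) ^ 3
      - 2 * real n * (real (n - 1) * p (Du 0 0) ^ (n - 2)) * p (Du 0 1) * p (Du 0 2)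
      - real n * p (Du 0 0) ^ (n - 1) * p (Du 0 3)"
  "pderiv_jet (Du 0 1) (equation n) p
    = (real n + 1) * (real n + 2) / 2 * p (Du 0 0) ^ n
      - 3 * (real n * (real n - 1) / 2) * p (Du 0 0) ^ (n - 2) * p (Du 0 1) ^ 2
      - 2 * real n * p (Du 0 0) ^ (n - 1) * p (Du 0 2)"
  "pderiv_jet (Du 0 2) (equation n) p = - 2 * real n * p (Du 0 0) ^ (n - 1) * p (Du 0 1)"
  "pderiv_jet (Du 0 3) (equation n) p = - (p (Du 0 0) ^ n)"
  "pderiv_jet (Du 1 0) (equation n) p = 1"
  "pderiv_jet (Du 1 1) (equation n) p = 0"
  "pderiv_jet (Du 1 2) (equation n) p = - 1"
  "pderiv_jet (Du 2 0) (equation n) p = 0"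
  "pderiv_jet (Du 2 1) (equation n) p = 0"
  "pderiv_jet (Du 3 0) (equation n) p = 0"
proof -
  have u: "DERIV (\<lambda>u. a - b + A * u ^ n * x - (B * u ^ m * c + C * u ^ k * x * d + u ^ n * e)) u
      :> A * (real n * u ^ (n - 1)) * x - B * (real m * u ^ (m - 1)) * c
         - C * (real k * u ^ (k - 1)) * x * d - real n * u ^ (n - 1) * e"
    for a b c d e x u A B C :: real and m k
    by (auto intro!: derivative_eq_intros simp: algebra_simps)
  have x: "DERIV (\<lambda>x. a - b + A * x - (B * x ^ 3 + C * x * d + e)) x
      :> A - 3 * B * x\<^sup>2 - C * d" for a b c d e x A B C :: real
    by (auto intro!: derivative_eq_intros simp: power2_eq_square)
  have lin: "DERIV (\<lambda>x. a + b * x) x :> b" for a b x :: real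
    by (auto intro!: derivative_eq_intros)
  have *: "n - 1 - 1 = n - 2" "n - 2 - 1 = n - 3" by simp_all
  note defs = pderiv_jet_def equation_def Let_def
  note [simp del] = One_nat_def
  show "pderiv_jet (Du 0 0) (equation n) p
    = (real n + 1) * (real n + 2) / 2 * (real n * p (Du 0 0) ^ (n - 1)) * p (Du 0 1)
      - real n * (real n - 1) / 2 * (real (n - 2) * p (Du 0 0) ^ (n - 3)) * p (Du 0 1) ^ 3
      - 2 * real n * (real (n - 1) * p (Du 0 0) ^ (n - 2)) * p (Du 0 1) * p (Du 0 2)
      - real n * p (Du 0 0) ^ (n - 1) * p (Du 0 3)"
    using DERIV_imp_deriv[OF u[of "p (Du 1 0)" "p (Du 1 2)" "(real n + 1) * (real n + 2) / 2"
        "p (Du 0 1)" "real n * (real n - 1) / 2" "n - 2" "p (Du 0 1) ^ 3" "2 * real n" "n - 1"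
        "p (Du 0 2)" "p (Du 0 3)" "p (Du 0 0)"]] by (simp add: defs *)
  show "pderiv_jet (Du 0 1) (equation n) p
    = (real n + 1) * (real n + 2) / 2 * p (Du 0 0) ^ n
      - 3 * (real n * (real n - 1) / 2) * p (Du 0 0) ^ (n - 2) * p (Du 0 1) ^ 2
      - 2 * real n * p (Du 0 0) ^ (n - 1) * p (Du 0 2)"
    using DERIV_imp_deriv[OF x[of "p (Du 1 0)" "p (Du 1 2)"
        "(real n + 1) * (real n + 2) / 2 * p (Du 0 0) ^ n"
        "real n * (real n - 1) / 2 * p (Du 0 0) ^ (n - 2)" "2 * real n * p (Du 0 0) ^ (n - 1)"
        "p (Du 0 2)" "p (Du 0 0) ^ n * p (Du 0 3)" "p (Du 0 1)"]] by (simp add: defs mult.assoc)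
  \<comment> \<open>The equation is affine in each of the remaining coordinates; the intercept is
    its value with that coordinate set to 0.\<close>
  have linI: "deriv f x = b" if "\<And>s. f s = a + b * s" for f :: "real \<Rightarrow> real" and a b x
  proof -
    have "f = (\<lambda>s. a + b * s)" using that by auto
    then show ?thesis using DERIV_imp_deriv[OF lin] by simp
  qed
  show "pderiv_jet (Du 0 2) (equation n) p = - 2 * real n * p (Du 0 0) ^ (n - 1) * p (Du 0 1)"
    unfolding pderiv_jet_def
    by (rule linI[where a = "equation n (p(Du 0 2 := 0))"]) (simp add: defs)
  show "pderiv_jet (Du 0 3) (equation n) p = - (p (Du 0 0) ^ n)"
    unfolding pderiv_jet_def
    by (rule linI[where a = "equation n (p(Du 0 3 := 0))"]) (simp add: defs)
  show "pderiv_jet (Du 1 0) (equation n) p = 1"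
    unfolding pderiv_jet_def
    by (rule linI[where a = "equation n (p(Du 1 0 := 0))"]) (simp add: defs)
  show "pderiv_jet (Du 1 2) (equation n) p = - 1"
    unfolding pderiv_jet_def
    by (rule linI[where a = "equation n (p(Du 1 2 := 0))"]) (simp add: defs)
qed (simp_all add: pderiv_jet_def equation_def)

text \<open>The equation does not contain \<open>u_tx\<close>, \<open>u_tt\<close>,
  \<open>u_ttx\<close> and \<open>u_ttt\<close>, so only six prolongation coefficients
  survive.\<close>

lemma prolongation_equation:
  "prolongation 3 v (equation n) p =
     prol_coeff v 1 0 p - prol_coeff v 1 2 p
     + prol_coeff v 0 0 p *
       ((real n + 1) * (real n + 2) / 2 * (real n * p (Du 0 0) ^ (n - 1)) * p (Du 0 1)
        - real n * (real n - 1) / 2 * (real (n - 2) * p (Du 0 0) ^ (n - 3)) * p (Du 0 1) ^ 3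
        - 2 * real n * (real (n - 1) * p (Du 0 0) ^ (n - 2)) * p (Du 0 1) * p (Du 0 2)
        - real n * p (Du 0 0) ^ (n - 1) * p (Du 0 3))
     + prol_coeff v 0 1 p *
       ((real n + 1) * (real n + 2) / 2 * p (Du 0 0) ^ n
        - 3 * (real n * (real n - 1) / 2) * p (Du 0 0) ^ (n - 2) * p (Du 0 1) ^ 2
        - 2 * real n * p (Du 0 0) ^ (n - 1) * p (Du 0 2))
     - prol_coeff v 0 2 p * (2 * real n * p (Du 0 0) ^ (n - 1) * p (Du 0 1))
     - prol_coeff v 0 3 p * p (Du 0 0) ^ n"
  unfolding prolongation_def jet_index_3
  by (simp add: pderiv_jet_equation del: prol_coeff.simps One_nat_def)

section \<open>Consequences of vanishing partial derivatives\<close>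

lemmas total_derivative_defs = DT_def DX_def DXX_def DXXX_def DTX_def DTXX_def

lemma dirderiv_dirderiv_zero:
  fixes g :: "real \<times> real \<times> real \<Rightarrow> real"
  assumes "open S" "smooth_on S g" "\<And>q. q \<in> S \<Longrightarrow> dirderiv h g q = 0" "q \<in> S"
  shows "dirderiv k (dirderiv h g) q = 0" "dirderiv h (dirderiv k g) q = 0"
proof -
  show "dirderiv k (dirderiv h g) q = 0"
    by (rule dirderiv_zero_on_open[OF assms(1,4,3)])
  then show "dirderiv h (dirderiv k g) q = 0"
    using dirderiv_commute assms by metis
qed

text \<open>Partial derivatives of a function with g_u = 0 inherit this property by commuting, so
  all terms with \<open>\<partial>\<^sub>u\<close> drop out.\<close>

lemma total_derivatives_u_free:
  assumes "open S" "smooth_on S g" "\<And>q. q \<in> S \<Longrightarrow> \<partial>\<^sub>u g q = 0" "base p \<in> S"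
  shows "DT g p = \<partial>\<^sub>t g (base p)" "DX g p = \<partial>\<^sub>x g (base p)"
    "DXX g p = \<partial>\<^sub>x (\<partial>\<^sub>x g) (base p)" "DXXX g p = \<partial>\<^sub>x (\<partial>\<^sub>x (\<partial>\<^sub>x g)) (base p)"
    "DTX g p = \<partial>\<^sub>x (\<partial>\<^sub>t g) (base p)" "DTXX g p = \<partial>\<^sub>x (\<partial>\<^sub>x (\<partial>\<^sub>t g)) (base p)"
proof -
  have DX: "DX f p = \<partial>\<^sub>x f (base p)"
    if "\<And>q. q \<in> S \<Longrightarrow> \<partial>\<^sub>u f q = 0" for f using that assms(4) by (simp add: DX_def)
  have zero: "\<partial>\<^sub>u f q = 0 \<and> \<partial>\<^sub>u (dirderiv h f) q = 0 \<and> \<partial>\<^sub>u (\<partial>\<^sub>u f) q = 0 \<and> dirderiv h (\<partial>\<^sub>u f) q = 0"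
    if "smooth_on S f" "\<And>q. q \<in> S \<Longrightarrow> \<partial>\<^sub>u f q = 0" "q \<in> S" for f h q
    using dirderiv_dirderiv_zero[OF assms(1) that(1) that(2) that(3)] that by simp
  have DXX: "DXX f p = \<partial>\<^sub>x (\<partial>\<^sub>x f) (base p)"
    if "smooth_on S f" "\<And>q. q \<in> S \<Longrightarrow> \<partial>\<^sub>u f q = 0" for f
    using zero[OF that] assms(4) by (simp add: DXX_def DX_def)
  have g: "smooth_on S (dirderiv h g)" "\<And>q. q \<in> S \<Longrightarrow> \<partial>\<^sub>u (dirderiv h g) q = 0" for h
    using zero[OF assms(2,3)] smooth_on_dirderiv[OF assms(2)] by auto
  show "DT g p = \<partial>\<^sub>t g (base p)" "DX g p = \<partial>\<^sub>x g (base p)"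
    "DXX g p = \<partial>\<^sub>x (\<partial>\<^sub>x g) (base p)"
    using DXX assms DX by (auto simp: DT_def)
  have gu: "DX (\<partial>\<^sub>u g) p = 0" "DXX (\<partial>\<^sub>u g) p = 0"
  proof -
    show "DX (\<partial>\<^sub>u g) p = 0" using zero[OF assms(2,3)] assms(4) DX[OF g(2)] by simp
    have "\<partial>\<^sub>x (\<partial>\<^sub>x (\<partial>\<^sub>u g)) (base p) = 0"
      by (rule dirderiv_zero_on_open[OF assms(1,4)]) (use zero[OF assms(2,3)] in blast)
    then show "DXX (\<partial>\<^sub>u g) p = 0" using DXX[OF g] by simp
  qed
  show "DXXX g p = \<partial>\<^sub>x (\<partial>\<^sub>x (\<partial>\<^sub>x g)) (base p)" "DTX g p = \<partial>\<^sub>x (\<partial>\<^sub>t g) (base p)"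
    "DTXX g p = \<partial>\<^sub>x (\<partial>\<^sub>x (\<partial>\<^sub>t g)) (base p)"
    using DXX[OF g] DX[OF g(2)] assms gu by (auto simp: DXXX_def DTX_def DTXX_def)
qed

lemma total_x_derivatives_t_only:
  assumes "open S" "smooth_on S g" "\<And>q. q \<in> S \<Longrightarrow> \<partial>\<^sub>x g q = 0" "\<And>q. q \<in> S \<Longrightarrow> \<partial>\<^sub>u g q = 0"
    "base p \<in> S"
  shows "DX g p = 0" "DXX g p = 0" "DXXX g p = 0" "DTX g p = 0" "DTXX g p = 0"
proof -
  note eqs = total_derivatives_u_free[OF assms(1,2,4,5)]
  have xx: "\<partial>\<^sub>x (\<partial>\<^sub>x g) q = 0" "\<partial>\<^sub>x (\<partial>\<^sub>t g) q = 0" if "q \<in> S" for q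
    using dirderiv_dirderiv_zero[OF assms(1,2,3) that] by auto
  show "DX g p = 0" "DXX g p = 0" "DTX g p = 0"
    using eqs xx assms(3,5) by auto
  show "DXXX g p = 0" "DTXX g p = 0"
    using eqs dirderiv_zero_on_open[OF assms(1,5)] xx by auto
qed

text \<open>By linearity the three partial derivatives determine the Frechet derivative, which is
  therefore zero; connectedness passes from local to global constancy.\<close>

lemma constant_on_connected:
  fixes g :: "real \<times> real \<times> real \<Rightarrow> real"
  assumes "open S" "connected S" "\<And>q. q \<in> S \<Longrightarrow> g differentiable (at q)"
    "\<And>q. q \<in> S \<Longrightarrow> \<partial>\<^sub>t g q = 0" "\<And>q. q \<in> S \<Longrightarrow> \<partial>\<^sub>x g q = 0" "\<And>q. q \<in> S \<Longrightarrow> \<partial>\<^sub>u g q = 0"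
  obtains c where "\<And>q. q \<in> S \<Longrightarrow> g q = c"
proof -
  have "(g has_derivative (\<lambda>h. 0)) (at q)" if q: "q \<in> S" for q
  proof -
    note D = has_derivative_dirderiv[OF assms(3)[OF q]]
    have "dirderiv h g q = 0" for h
    proof -
      have "h = fst h *\<^sub>R eT + fst (snd h) *\<^sub>R eX + snd (snd h) *\<^sub>R eU"
        by (simp add: eT_def eX_def eU_def prod_eq_iff)
      then have "dirderiv h g q
          = fst h * \<partial>\<^sub>t g q + fst (snd h) * \<partial>\<^sub>x g q + snd (snd h) * \<partial>\<^sub>u g q"
        using linear_add[OF has_derivative_linear[OF D]] linear_scale[OF has_derivative_linear[OF D]]
        by (metis real_scaleR_def)
      then show ?thesis using assms(4-6) q by simp
    qed
    with D show ?thesis by simp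
  qed
  moreover have "continuous_on S g"
    using assms(3) differentiable_imp_continuous_within continuous_at_imp_continuous_on by blast
  ultimately have "g constant_on S"
    using assms(1,2) by (intro has_derivative_zero_connected_constant_on[of S "{}"])
      (auto intro: has_derivative_at_withinI)
  then show thesis using that unfolding constant_on_def by blast
qed

subsection \<open>The determining equations\<close>

text \<open>The equation is solved for \<open>u\<^bsub>txx\<^esub>\<close>, so that the other jet coordinates can be chosen freely.\<close>

definition solution_jet ::
    "nat \<Rightarrow> real \<times> real \<times> real \<Rightarrow> real \<Rightarrow> real \<Rightarrow> real \<Rightarrow> real \<Rightarrow> real \<Rightarrow> real \<Rightarrow> jet" where
  "solution_jet n q ux ut utx uxx uttx uxxx = (\<lambda>_. 0)
     (Vt := fst q, Vx := fst (snd q), Du 0 0 := snd (snd q), Du 0 1 := ux, Du 1 0 := ut,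
      Du 1 1 := utx, Du 0 2 := uxx, Du 2 1 := uttx, Du 0 3 := uxxx,
      Du 1 2 := ut + (real n + 1) * (real n + 2) / 2 * snd (snd q) ^ n * ux
        - (real n * (real n - 1) / 2 * snd (snd q) ^ (n - 2) * ux ^ 3
           + 2 * real n * snd (snd q) ^ (n - 1) * ux * uxx + snd (snd q) ^ n * uxxx))"

lemma solution_jet_simps [simp]:
  "base (solution_jet n q ux ut utx uxx uttx uxxx) = q"
  "equation n (solution_jet n q ux ut utx uxx uttx uxxx) = 0"
  "solution_jet n q ux ut utx uxx uttx uxxx (Du 0 0) = snd (snd q)"
  "solution_jet n q ux ut utx uxx uttx uxxx (Du 0 1) = ux"
  "solution_jet n q ux ut utx uxx uttx uxxx (Du 0 2) = uxx"
  "solution_jet n q ux ut utx uxx uttx uxxx (Du 0 3) = uxxx"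
  "solution_jet n q ux ut utx uxx uttx uxxx (Du 1 0) = ut"
  "solution_jet n q ux ut utx uxx uttx uxxx (Du 1 1) = utx"
  "solution_jet n q ux ut utx uxx uttx uxxx (Du 2 0) = 0"
  "solution_jet n q ux ut utx uxx uttx uxxx (Du 2 1) = uttx"
  "solution_jet n q ux ut utx uxx uttx uxxx (Du 1 2) =
     ut + (real n + 1) * (real n + 2) / 2 * snd (snd q) ^ n * ux
        - (real n * (real n - 1) / 2 * snd (snd q) ^ (n - 2) * ux ^ 3
           + 2 * real n * snd (snd q) ^ (n - 1) * ux * uxx + snd (snd q) ^ n * uxxx)"
  by (auto simp: solution_jet_def base_def equation_def prod_eq_iff)

declare One_nat_def [simp del]

lemma differentiable_u_power [simp]: "(\<lambda>q::real \<times> real \<times> real. snd (snd q) ^ k) differentiable (at q)"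
  by (intro differentiable_power bounded_linear_imp_differentiable
      bounded_linear_compose[OF bounded_linear_snd bounded_linear_snd])

lemma dirderiv_u_power:
  "dirderiv h (\<lambda>q::real \<times> real \<times> real. snd (snd q) ^ k) q
    = real k * snd (snd q) ^ (k - 1) * snd (snd h)"
  by (rule dirderiv_eqI) (auto intro!: derivative_eq_intros)

lemma differentiable_u [simp]: "(\<lambda>q::real \<times> real \<times> real. snd (snd q)) differentiable (at q)"
  using differentiable_u_power[of 1] by simp

lemma dirderiv_u: "dirderiv h (\<lambda>q::real \<times> real \<times> real. snd (snd q)) q = snd (snd h)"
  using dirderiv_u_power[of h 1 q] by simp

text \<open>Points with u \<noteq> 0 are dense in \<open>S\<close>: a short step along
  \<open>eU\<close> leaves the plane u = 0. This justifies the cancellation of powers of u.\<close>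

lemma zero_on_open_of_u_nonzero:
  fixes g :: "real \<times> real \<times> real \<Rightarrow> real"
  assumes "open S" "continuous_on S g" "\<And>q. q \<in> S \<Longrightarrow> snd (snd q) \<noteq> 0 \<Longrightarrow> g q = 0" "q \<in> S"
  shows "g q = 0"
proof (rule ccontr)
  assume q: "g q \<noteq> 0"
  have "open (g -` (- {0}) \<inter> S)"
    using continuous_on_open_vimage[OF assms(1)] assms(2) by blast
  then obtain e where e: "e > 0" "ball q e \<subseteq> g -` (- {0}) \<inter> S"
    using q \<open>q \<in> S\<close> by (metis (no_types, lifting) ComplI IntI openE singletonD vimageI)
  have "q + (e / 2) *\<^sub>R eU \<in> ball q e"
    using e(1) by (simp add: dist_norm eU_def norm_Pair)
  then have "q + (e / 2) *\<^sub>R eU \<in> S" "g (q + (e / 2) *\<^sub>R eU) \<noteq> 0" using e(2) by auto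
  moreover have "snd (snd q) = 0" using assms(3,4) q by blast
  then have "snd (snd (q + (e / 2) *\<^sub>R eU)) \<noteq> 0" using e(1) by (simp add: eU_def)
  ultimately show False using assms(3) by blast
qed

locale equation_symmetry = point_vector_field +
  fixes n :: nat
  assumes n: "n \<ge> 1"
    and symmetry: "\<And>p. base p \<in> S \<Longrightarrow> equation n p = 0 \<Longrightarrow> prolongation 3 v (equation n) p = 0"
begin

text \<open>An identity in six free values, in the order u_x, u_t, u_tx, u_xx, u_ttx, u_xxx; the
  determining equations are read off by inserting particular numbers.\<close>

lemma invariance:
  assumes "q \<in> S"
  shows "prolongation 3 v (equation n) (solution_jet n q ux ut utx uxx uttx uxxx) = 0"
  by (rule symmetry) (simp_all add: assms)

lemmas expand_prolongation = prolongation_equation prol_coeff_00 prol_coeff_10 prol_coeff_01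
  prol_coeff_02 prol_coeff_03 prol_coeff_12

text \<open>Raising u_ttx from 0 to 1 changes the identity by \<open>2 * DX T\<close>, hence
  \<tau>_x + d \<tau>_u = 0 for every value \<open>d\<close> of u_x.\<close>

lemma tau_x_u_zero:
  assumes "q \<in> S"
  shows "\<partial>\<^sub>x T q = 0" "\<partial>\<^sub>u T q = 0"
proof -
  have "\<partial>\<^sub>x T q + d * \<partial>\<^sub>u T q = 0" for d
    using invariance[OF assms, of d 0 0 0 0 0] invariance[OF assms, of d 0 0 0 1 0]
    by (simp add: expand_prolongation assms total_derivative_defs del: prol_coeff.simps)
  from this[of 0] this[of 1] show "\<partial>\<^sub>x T q = 0" "\<partial>\<^sub>u T q = 0" by simp_all
qed

lemmas tau_total = total_x_derivatives_t_only[OF S sm(1) tau_x_u_zero]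
  total_derivatives_u_free(1)[OF S sm(1) tau_x_u_zero(2)]

text \<open>The coefficients of \<open>u\<^bsub>tx\<^esub> u\<^bsub>xx\<^esub>\<close>, \<open>u\<^bsub>tx\<^esub>\<close> and \<open>u\<^bsub>xx\<^esub>\<close> at jets with \<open>u\<^bsub>x\<^esub> = u\<^bsub>t\<^esub> = u\<^bsub>xxx\<^esub> = 0\<close>.\<close>

lemma determining_equations_1:
  assumes "q \<in> S"
  shows "\<partial>\<^sub>u X q = 0" "2 * \<partial>\<^sub>x (\<partial>\<^sub>u Y) q = \<partial>\<^sub>x (\<partial>\<^sub>x X) q"
    "- \<partial>\<^sub>u (\<partial>\<^sub>t Y) q + 2 * \<partial>\<^sub>x (\<partial>\<^sub>t X) q - 2 * real n * snd (snd q) ^ (n - 1) * \<partial>\<^sub>x Y q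
      - snd (snd q) ^ n * (3 / 2 * \<partial>\<^sub>x (\<partial>\<^sub>x X) q - 3 * \<partial>\<^sub>x (\<partial>\<^sub>x X) q) = 0"
proof -
  \<comment> \<open>Four jets with u_tx and u_xx in {0, 1}: the mixed second difference isolates 3
    \<xi>_u, the coefficient of the product. The single differences then give the other two
    equations.\<close>
  note i = invariance[OF assms, of 0 0 0 0 0 0] invariance[OF assms, of 0 0 0 1 0 0]
    invariance[OF assms, of 0 0 1 0 0 0] invariance[OF assms, of 0 0 1 1 0 0]
  note i' = i[simplified expand_prolongation assms solution_jet_simps tau_total, simplified,
      simplified total_derivative_defs, simplified]
  have c: "\<partial>\<^sub>u (\<partial>\<^sub>x Y) q = \<partial>\<^sub>x (\<partial>\<^sub>u Y) q" by (rule dirderiv_commute[OF sm(3) S assms])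
  show u: "\<partial>\<^sub>u X q = 0" using i' by (simp add: algebra_simps)
  show xu: "2 * \<partial>\<^sub>x (\<partial>\<^sub>u Y) q = \<partial>\<^sub>x (\<partial>\<^sub>x X) q" using i' by (simp add: algebra_simps)
  show "- \<partial>\<^sub>u (\<partial>\<^sub>t Y) q + 2 * \<partial>\<^sub>x (\<partial>\<^sub>t X) q - 2 * real n * snd (snd q) ^ (n - 1) * \<partial>\<^sub>x Y q
      - snd (snd q) ^ n * (3 / 2 * \<partial>\<^sub>x (\<partial>\<^sub>x X) q - 3 * \<partial>\<^sub>x (\<partial>\<^sub>x X) q) = 0"
    using i'(1,2) c u unfolding xu[symmetric] by (simp add: algebra_simps)
qed

lemmas xi_total = total_derivatives_u_free[OF S sm(2) determining_equations_1(1)]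

text \<open>The coefficients of \<open>u\<^bsub>xxx\<^esub>\<close> and \<open>u\<^bsub>t\<^esub>\<close> at jets with \<open>u\<^bsub>x\<^esub> = u\<^bsub>tx\<^esub> = u\<^bsub>xx\<^esub> = 0\<close>.\<close>

lemma determining_equations_2:
  assumes "q \<in> S"
  shows "\<partial>\<^sub>t X q + snd (snd q) ^ n * \<partial>\<^sub>x X q - snd (snd q) ^ n * \<partial>\<^sub>t T q
      - real n * snd (snd q) ^ (n - 1) * Y q = 0"
    "\<partial>\<^sub>x (\<partial>\<^sub>x (\<partial>\<^sub>u Y)) q = 2 * \<partial>\<^sub>x X q"
proof -
  \<comment> \<open>Raising u_xxx by 1 lowers the dependent u_txx by u^n, which cancels \<eta>_u in
    the first equation. Raising u_t raises u_txx equally, which cancels \<eta>_u - \<tau>_t and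
    leaves 2 \<xi>_x - \<eta>_uxx.\<close>
  note i = invariance[OF assms, of 0 0 0 0 0 0] invariance[OF assms, of 0 0 0 0 0 1]
    invariance[OF assms, of 0 1 0 0 0 0]
  note i' = i[simplified expand_prolongation assms solution_jet_simps tau_total xi_total, simplified,
      simplified total_derivative_defs, simplified]
  show "\<partial>\<^sub>t X q + snd (snd q) ^ n * \<partial>\<^sub>x X q - snd (snd q) ^ n * \<partial>\<^sub>t T q
      - real n * snd (snd q) ^ (n - 1) * Y q = 0"
    using i'(1,2) by (simp add: algebra_simps)
  show "\<partial>\<^sub>x (\<partial>\<^sub>x (\<partial>\<^sub>u Y)) q = 2 * \<partial>\<^sub>x X q"
    using i'(1,3) by (simp add: algebra_simps)
qed

text \<open>At u_x = 1 the coefficient of u_tx is, up to sign, 2 \<eta>_uu + (2 \<eta>_ux -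
  \<xi>_xx), and the bracket is already known to vanish.\<close>

lemma eta_uu_zero:
  assumes "q \<in> S"
  shows "\<partial>\<^sub>u (\<partial>\<^sub>u Y) q = 0"
proof -
  note i = invariance[OF assms, of 1 0 0 0 0 0] invariance[OF assms, of 1 0 1 0 0 0]
  note i' = i[simplified expand_prolongation assms solution_jet_simps tau_total xi_total, simplified,
      simplified total_derivative_defs, simplified]
  show ?thesis
    using i' determining_equations_1(2)[OF assms] by (simp add: algebra_simps)
qed

section \<open>Differential consequences of the determining equations\<close>

text \<open>The x-derivative of the u_xxx equation; its term with \<tau>_tx is zero because \<tau>_x
  = 0.\<close>

lemma xi_tx_eta_x:
  assumes "q \<in> S"
  shows "real n * snd (snd q) ^ (n - 1) * \<partial>\<^sub>x Y q
    = \<partial>\<^sub>x (\<partial>\<^sub>t X) q + snd (snd q) ^ n * \<partial>\<^sub>x (\<partial>\<^sub>x X) q"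
proof -
  let ?G = "\<lambda>q. \<partial>\<^sub>t X q + snd (snd q) ^ n * \<partial>\<^sub>x X q - snd (snd q) ^ n * \<partial>\<^sub>t T q
      - real n * (snd (snd q) ^ (n - 1) * Y q)"
  have "\<partial>\<^sub>x ?G q = 0"
    using determining_equations_2(1) by (intro dirderiv_zero_on_open[OF S assms]) (simp add: mult.assoc)
  moreover have "\<partial>\<^sub>x ?G q = \<partial>\<^sub>x (\<partial>\<^sub>t X) q + snd (snd q) ^ n * \<partial>\<^sub>x (\<partial>\<^sub>x X) q
      - snd (snd q) ^ n * \<partial>\<^sub>x (\<partial>\<^sub>t T) q - real n * (snd (snd q) ^ (n - 1) * \<partial>\<^sub>x Y q)"
    using assms
    by (simp add: dirderiv_add dirderiv_diff dirderiv_mult dirderiv_u_power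
        smooth_on_differentiable[OF sm(3)] smooth_on_differentiable[OF smooth_on_dirderiv[OF sm(1)]]
        smooth_on_differentiable[OF smooth_on_dirderiv[OF sm(2)]])
  moreover have "\<partial>\<^sub>x (\<partial>\<^sub>t T) q = 0"
    by (rule dirderiv_dirderiv_zero(2)[OF S sm(1) tau_x_u_zero(1) assms])
  ultimately show ?thesis by simp
qed

text \<open>Eliminating \<eta>_x from the u_xx equation by \<open>xi_tx_eta_x\<close> also cancels
  \<xi>_tx; what remains is -1/2 times the left-hand side here.\<close>

lemma eta_ut:
  assumes "q \<in> S"
  shows "2 * \<partial>\<^sub>u (\<partial>\<^sub>t Y) q + snd (snd q) ^ n * \<partial>\<^sub>x (\<partial>\<^sub>x X) q = 0"
  using determining_equations_1(3)[OF assms] xi_tx_eta_x[OF assms] by (simp add: algebra_simps)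

text \<open>In the u-derivative of \<open>eta_ut\<close> the terms with \<eta>_tuu and \<xi>_xxu
  vanish since \<eta>_uu = \<xi>_u = 0. This leaves n u^(n-1) \<xi>_xx = 0.\<close>

lemma xi_xx_zero:
  assumes "q \<in> S"
  shows "\<partial>\<^sub>x (\<partial>\<^sub>x X) q = 0"
proof (rule zero_on_open_of_u_nonzero[OF S _ _ assms])
  show "continuous_on S (\<partial>\<^sub>x (\<partial>\<^sub>x X))"
    by (intro smooth_on_continuous smooth_on_dirderiv sm)
  fix q assume q: "q \<in> S" and u: "snd (snd q) \<noteq> 0"
  let ?G = "\<lambda>q. 2 * \<partial>\<^sub>u (\<partial>\<^sub>t Y) q + snd (snd q) ^ n * \<partial>\<^sub>x (\<partial>\<^sub>x X) q"
  have "\<partial>\<^sub>u ?G q = 0"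
    using eta_ut by (intro dirderiv_zero_on_open[OF S q])
  moreover have "\<partial>\<^sub>u ?G q = 2 * \<partial>\<^sub>u (\<partial>\<^sub>u (\<partial>\<^sub>t Y)) q
      + (real n * snd (snd q) ^ (n - 1) * \<partial>\<^sub>x (\<partial>\<^sub>x X) q
        + snd (snd q) ^ n * \<partial>\<^sub>u (\<partial>\<^sub>x (\<partial>\<^sub>x X)) q)"
    using q
    by (simp add: dirderiv_add dirderiv_diff dirderiv_mult dirderiv_u_power
        smooth_on_differentiable[OF smooth_on_dirderiv[OF smooth_on_dirderiv[OF sm(2)]]]
        smooth_on_differentiable[OF smooth_on_dirderiv[OF smooth_on_dirderiv[OF sm(3)]]])
  moreover have "\<partial>\<^sub>u (\<partial>\<^sub>x (\<partial>\<^sub>x X)) q = 0"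
    using dirderiv_dirderiv_zero(2)[OF S sm(2) determining_equations_1(1)]
    by (intro dirderiv_dirderiv_zero(2)[OF S smooth_on_dirderiv[OF sm(2)] _ q])
  moreover have "\<partial>\<^sub>u (\<partial>\<^sub>u (\<partial>\<^sub>t Y)) q = \<partial>\<^sub>u (\<partial>\<^sub>t (\<partial>\<^sub>u Y)) q"
    using q sm dirderiv_commute[OF sm(3) S]
    by (intro dirderiv_cong_open[OF _ S] smooth_on_differentiable[where S = S] smooth_on_dirderiv)
  moreover have "\<partial>\<^sub>u (\<partial>\<^sub>t (\<partial>\<^sub>u Y)) q = 0"
    by (rule dirderiv_dirderiv_zero(2)[OF S smooth_on_dirderiv[OF sm(3)] eta_uu_zero q])
  ultimately show "\<partial>\<^sub>x (\<partial>\<^sub>x X) q = 0" using u n by simp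
qed

lemma eta_ux_zero: "q \<in> S \<Longrightarrow> \<partial>\<^sub>x (\<partial>\<^sub>u Y) q = 0"
  using determining_equations_1(2) xi_xx_zero by simp

text \<open>\<eta>_ux = 0 on all of \<open>S\<close> gives \<eta>_uxx = 0, which equals 2
  \<xi>_x.\<close>

lemma xi_x_zero:
  assumes "q \<in> S"
  shows "\<partial>\<^sub>x X q = 0"
proof -
  have "\<partial>\<^sub>x (\<partial>\<^sub>x (\<partial>\<^sub>u Y)) q = 0"
    by (rule dirderiv_zero_on_open[OF S assms eta_ux_zero])
  then show ?thesis using determining_equations_2(2)[OF assms] by simp
qed

text \<open>With \<xi>_tx = \<xi>_xx = 0 only n u^(n-1) \<eta>_x is left in
  \<open>xi_tx_eta_x\<close>.\<close>

lemma eta_x_zero: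
  assumes "q \<in> S"
  shows "\<partial>\<^sub>x Y q = 0"
proof (rule zero_on_open_of_u_nonzero[OF S _ _ assms])
  show "continuous_on S (\<partial>\<^sub>x Y)" by (intro smooth_on_continuous smooth_on_dirderiv sm)
  fix q assume q: "q \<in> S" and u: "snd (snd q) \<noteq> 0"
  have "\<partial>\<^sub>x (\<partial>\<^sub>t X) q = 0"
    by (rule dirderiv_dirderiv_zero(2)[OF S sm(2) xi_x_zero q])
  then show "\<partial>\<^sub>x Y q = 0" using xi_tx_eta_x[OF q] xi_xx_zero[OF q] u n by simp
qed

lemma eta_ut_zero:
  assumes "q \<in> S"
  shows "\<partial>\<^sub>u (\<partial>\<^sub>t Y) q = 0" "\<partial>\<^sub>t (\<partial>\<^sub>u Y) q = 0"
proof -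
  show "\<partial>\<^sub>u (\<partial>\<^sub>t Y) q = 0" using eta_ut[OF assms] xi_xx_zero[OF assms] by simp
  then show "\<partial>\<^sub>t (\<partial>\<^sub>u Y) q = 0" using dirderiv_commute[OF sm(3) S assms] by metis
qed

text \<open>Along jets whose only derivative coordinates are \<open>u\<^bsub>x\<^esub> = d\<close> and \<open>u\<^bsub>txx\<^esub>\<close>, invariance is a polynomial
  in \<open>d\<close>, whose linear coefficient is a multiple of \<open>\<xi>\<^sub>t\<close> by the \<open>u\<^bsub>xxx\<^esub>\<close> equation.\<close>

lemma xi_t_zero:
  assumes "q \<in> S"
  shows "\<partial>\<^sub>t X q = 0"
proof -
  let ?A = "(real n + 1) * (real n + 2) / 2" and ?u = "snd (snd q)"
  note t = total_x_derivatives_t_only(1,2)[OF S smooth_on_dirderiv[OF sm(3)]]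
  note z = dirderiv_dirderiv_zero[OF S sm(3) eta_x_zero]
  have Y: "DX (\<partial>\<^sub>x Y) p = 0" "DXX (\<partial>\<^sub>x Y) p = 0" "DX (\<partial>\<^sub>u Y) p = 0" "DXX (\<partial>\<^sub>u Y) p = 0"
    "DXX (\<partial>\<^sub>t Y) p = 0" if "base p = q" for p
  proof -
    have p: "base p \<in> S" using that assms by simp
    show "DX (\<partial>\<^sub>x Y) p = 0" "DXX (\<partial>\<^sub>x Y) p = 0" by (rule t[OF z(1) z(1) p]; assumption)+
    show "DX (\<partial>\<^sub>u Y) p = 0" "DXX (\<partial>\<^sub>u Y) p = 0"
      by (rule t[OF z(2) eta_uu_zero p]; assumption)+
    show "DXX (\<partial>\<^sub>t Y) p = 0" by (rule t[OF z(2) eta_ut_zero(1) p]; assumption)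
  qed
  have X: "DX X p = 0" "DXX X p = 0" "DXXX X p = 0" "DTX X p = 0" "DTXX X p = 0" if "base p = q" for p
    by (rule total_x_derivatives_t_only[OF S sm(2) xi_x_zero determining_equations_1(1)]; simp add: that assms)+
  \<comment> \<open>At these jets u_txx is \<open>?A * ?u ^ n * d\<close> minus a multiple of
    \<open>d ^ 3\<close>, so its coefficient, built from \<eta>_u - \<tau>_t, contributes to both
    \<open>c1\<close> and \<open>c3\<close>.\<close>
  define c1 where "c1 = - \<partial>\<^sub>t X q - ?A * ?u ^ n * (\<partial>\<^sub>u Y q - \<partial>\<^sub>t T q)
      + ?A * (real n * ?u ^ (n - 1) * Y q) + ?A * ?u ^ n * \<partial>\<^sub>u Y q"
  define c3 where "c3 = real n * (real n - 1) / 2 * (?u ^ (n - 2) * (\<partial>\<^sub>u Y q - \<partial>\<^sub>t T q)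
      - real (n - 2) * ?u ^ (n - 3) * Y q - 3 * ?u ^ (n - 2) * \<partial>\<^sub>u Y q)"
  have e: "\<partial>\<^sub>t Y q + c1 * d + c3 * d ^ 3 = 0" for d
  proof -
    have p: "base (solution_jet n q d 0 0 0 0 0) = q" by simp
    have "0 = prolongation 3 v (equation n) (solution_jet n q d 0 0 0 0 0)"
      using invariance[OF assms] by simp
    also have "\<dots> = \<partial>\<^sub>t Y q + c1 * d + c3 * d ^ 3"
      by (simp add: expand_prolongation assms tau_total X[OF p] Y[OF p] xi_total(1) eta_x_zero
          DT_def[of Y] DX_def[of Y] DXX_def[of Y] DXXX_def[of Y] DTXX_def[of Y] c1_def c3_def
          del: prol_coeff.simps)
        (simp add: field_simps power2_eq_square power3_eq_cube)
    finally show ?thesis by simp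
  qed
  \<comment> \<open>The odd parts at 1 and 2 give \<open>c1 + c3 = 0\<close> and
    \<open>c1 + 4 * c3 = 0\<close>.\<close>
  have "c1 = 0" using e[of 1] e[of "-1"] e[of 2] e[of "-2"] by simp
  moreover have "\<partial>\<^sub>t X q - ?u ^ n * \<partial>\<^sub>t T q - real n * ?u ^ (n - 1) * Y q = 0"
    using determining_equations_2(1)[OF assms] xi_x_zero[OF assms] by simp
  then have "real n * ?u ^ (n - 1) * Y q = \<partial>\<^sub>t X q - ?u ^ n * \<partial>\<^sub>t T q" by simp
  \<comment> \<open>The factor after the second \<open>?A\<close> vanishes by the u_xxx
    equation.\<close>
  moreover have "c1 = (?A - 1) * \<partial>\<^sub>t X q
      + ?A * (real n * ?u ^ (n - 1) * Y q - (\<partial>\<^sub>t X q - ?u ^ n * \<partial>\<^sub>t T q))"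
    unfolding c1_def by (simp add: field_simps)
  ultimately have "(?A - 1) * \<partial>\<^sub>t X q = 0" by (metis add.right_neutral diff_self mult_zero_right)
  \<comment> \<open>For n \<ge> 1 this makes \<open>?A\<close> at least 3, so \<open>?A - 1\<close>
    can be cancelled.\<close>
  moreover have "(real n + 1) * (real n + 2) \<ge> 2 * 3" using n by (intro mult_mono) auto
  ultimately show ?thesis by auto
qed

text \<open>With \<xi>_x = \<xi>_t = 0 the u_xxx equation says that u^(n-1) times this expression is
  zero.\<close>

lemma eta_tau_t:
  assumes "q \<in> S"
  shows "real n * Y q + snd (snd q) * \<partial>\<^sub>t T q = 0"
proof (rule zero_on_open_of_u_nonzero[OF S _ _ assms])
  show "continuous_on S (\<lambda>q. real n * Y q + snd (snd q) * \<partial>\<^sub>t T q)"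
    by (intro continuous_intros smooth_on_continuous smooth_on_dirderiv sm)
  fix q assume q: "q \<in> S" and u: "snd (snd q) \<noteq> 0"
  have "snd (snd q) ^ n = snd (snd q) ^ (n - 1) * snd (snd q)"
    using n by (cases n) auto
  then have "snd (snd q) ^ (n - 1) * (real n * Y q + snd (snd q) * \<partial>\<^sub>t T q) = 0"
    using determining_equations_2(1)[OF q] xi_x_zero[OF q] xi_t_zero[OF q] by (simp add: algebra_simps)
  then show "real n * Y q + snd (snd q) * \<partial>\<^sub>t T q = 0" using u by simp
qed

text \<open>The u-derivative of \<open>eta_tau_t\<close>, with \<tau>_tu = 0; once \<eta>_u is
  constant it makes \<tau> affine in t.\<close>

lemma tau_t:
  assumes "q \<in> S"
  shows "\<partial>\<^sub>t T q = - real n * \<partial>\<^sub>u Y q"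
proof -
  let ?G = "\<lambda>q. real n * Y q + snd (snd q) * \<partial>\<^sub>t T q"
  have "\<partial>\<^sub>u ?G q = 0"
    using eta_tau_t by (intro dirderiv_zero_on_open[OF S assms]) simp
  moreover have "\<partial>\<^sub>u ?G q = real n * \<partial>\<^sub>u Y q + (snd (snd q) * \<partial>\<^sub>u (\<partial>\<^sub>t T) q + \<partial>\<^sub>t T q)"
    using assms
    by (simp add: dirderiv_add dirderiv_mult dirderiv_u
        smooth_on_differentiable[OF sm(3)] smooth_on_differentiable[OF smooth_on_dirderiv[OF sm(1)]])
  moreover have "\<partial>\<^sub>u (\<partial>\<^sub>t T) q = 0"
    by (rule dirderiv_dirderiv_zero(2)[OF S sm(1) tau_x_u_zero(2) assms])
  ultimately show ?thesis by simp
qed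

lemma eta_linear:
  assumes "q \<in> S"
  shows "Y q = snd (snd q) * \<partial>\<^sub>u Y q"
proof -
  have "real n * (Y q - snd (snd q) * \<partial>\<^sub>u Y q) = 0"
    using eta_tau_t[OF assms] tau_t[OF assms] by (simp add: algebra_simps)
  then show ?thesis using n by simp
qed

text \<open>The functions \<eta>_u, \<xi> and \<tau> + n c t have zero gradient and are constants c,
  b and a. The coefficient of \<open>v3 n\<close> is \<open>- c\<close> because its u-component is
  -u.\<close>

lemma symmetry_generator_classification:
  assumes "connected S"
  shows "\<exists>a b c. \<forall>q\<in>S. v q = a *\<^sub>R v1 q + b *\<^sub>R v2 q + c *\<^sub>R v3 n q"
proof -
  obtain c where c: "\<And>q. q \<in> S \<Longrightarrow> \<partial>\<^sub>u Y q = c"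
    by (rule constant_on_connected[OF S assms, of "\<partial>\<^sub>u Y"])
      (use smooth_on_differentiable[OF smooth_on_dirderiv[OF sm(3)]]
        eta_ut_zero(2) eta_ux_zero eta_uu_zero in auto)
  obtain b where b: "\<And>q. q \<in> S \<Longrightarrow> X q = b"
    by (rule constant_on_connected[OF S assms, of X])
      (use smooth_on_differentiable[OF sm(2)] xi_t_zero xi_x_zero determining_equations_1(1) in auto)
  let ?f = "\<lambda>q. T q + real n * c * fst q"
  have lin: "dirderiv h (\<lambda>q. real n * c * fst q) q = real n * c * fst h"
    "(\<lambda>q. real n * c * fst q) differentiable (at q)" for h q :: "real \<times> real \<times> real"
    by (rule dirderiv_eqI bounded_linear_imp_has_derivative bounded_linear_imp_differentiable
        bounded_linear_const_mult bounded_linear_fst)+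
  have "dirderiv h ?f q = dirderiv h T q + real n * c * fst h" if "q \<in> S" for h q
    using dirderiv_add[OF smooth_on_differentiable[OF sm(1) that] lin(2)] lin(1) by simp
  moreover have "?f differentiable (at q)" if "q \<in> S" for q
    by (rule differentiable_add[OF smooth_on_differentiable[OF sm(1) that] lin(2)])
  ultimately obtain a where a: "\<And>q. q \<in> S \<Longrightarrow> ?f q = a"
    by (rule_tac constant_on_connected[OF S assms, of ?f]) (simp_all add: tau_x_u_zero tau_t c)
  have "v q = a *\<^sub>R v1 q + b *\<^sub>R v2 q + (- c) *\<^sub>R v3 n q" if "q \<in> S" for q
    using a[OF that] b[OF that] c[OF that] eta_linear[OF that]
    by (cases q) (auto simp: v v1_def v2_def v3_def)
  then show ?thesis by blast
qed

end

subsection \<open>The three generators\<close>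

text \<open>All prolongation coefficients that occur are zero for constant components, and t does
  not appear explicitly; the prolongation vanishes on every jet over \<open>S\<close>.\<close>

lemma translation_t_symmetry:
  assumes "open S"
  shows "lie_point_symmetry_generator 3 (equation n) S v1"
proof -
  interpret point_vector_field S "\<lambda>q. 1" "\<lambda>q. 0" "\<lambda>q. 0" v1
    by unfold_locales (auto simp: v1_def smooth_on_const assms)
  have "prolongation 3 v1 (equation n) p = 0" if "base p \<in> S" for p
    using that
    by (simp add: prolongation_equation prol_coeff_00 prol_coeff_10 prol_coeff_01 prol_coeff_02
        prol_coeff_03 prol_coeff_12 total_derivative_defs del: prol_coeff.simps)
  moreover have "smooth_on S v1"
    using smooth_on_const[of S "(1, 0, 0)"] by (simp add: v1_def case_prod_unfold)
  ultimately show ?thesis by (simp add: lie_point_symmetry_generator_def)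
qed

lemma translation_x_symmetry:
  assumes "open S"
  shows "lie_point_symmetry_generator 3 (equation n) S v2"
proof -
  interpret point_vector_field S "\<lambda>q. 0" "\<lambda>q. 1" "\<lambda>q. 0" v2
    by unfold_locales (auto simp: v2_def smooth_on_const assms)
  have "prolongation 3 v2 (equation n) p = 0" if "base p \<in> S" for p
    using that
    by (simp add: prolongation_equation prol_coeff_00 prol_coeff_10 prol_coeff_01 prol_coeff_02
        prol_coeff_03 prol_coeff_12 total_derivative_defs del: prol_coeff.simps)
  moreover have "smooth_on S v2"
    using smooth_on_const[of S "(0, 1, 0)"] by (simp add: v2_def case_prod_unfold)
  ultimately show ?thesis by (simp add: lie_point_symmetry_generator_def)
qed

text \<open>With weight n for t and -1 for u, every term of the equation has weight -(n + 1), so the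
  prolongation is this multiple of the equation itself.\<close>

lemma scaling_symmetry:
  assumes "open S" "n \<ge> 1"
  shows "lie_point_symmetry_generator 3 (equation n) S (v3 n)"
proof -
  have L: "bounded_linear (\<lambda>q::real \<times> real \<times> real. real n * fst q)"
    "bounded_linear (\<lambda>q::real \<times> real \<times> real. - snd (snd q))"
    by (intro bounded_linear_const_mult bounded_linear_fst bounded_linear_minus
        bounded_linear_compose[OF bounded_linear_snd bounded_linear_snd])+
  have v3: "v3 n = (\<lambda>q. (real n * fst q, 0, - snd (snd q)))"
    by (auto simp: v3_def)
  interpret point_vector_field S "\<lambda>q. real n * fst q" "\<lambda>q. 0" "\<lambda>q. - snd (snd q)" "v3 n"
    by unfold_locales (simp_all add: assms smooth_on_const smooth_on_bounded_linear[OF L(1)]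
        smooth_on_bounded_linear[OF L(2)] v3)
  have D: "dirderiv h (\<lambda>q. real n * fst q) = (\<lambda>q. real n * fst h)"
    "dirderiv h (\<lambda>q. - snd (snd q)) = (\<lambda>q. - snd (snd h))" for h :: "real \<times> real \<times> real"
    using L[THEN bounded_linear_imp_has_derivative] by (auto intro!: ext dirderiv_eqI)
  have pow: "(real n - 1) * p ^ (n - 2) * p = (real n - 1) * p ^ (n - 1)"
    "real n * p ^ (n - 1) * p = real n * p ^ n"
    "real (n - 2) * p ^ (n - 3) * p = real (n - 2) * p ^ (n - 2)"
    "real (n - 1) = real n - 1" "(real n - 1) * real (n - 2) = (real n - 1) * (real n - 2)" for p :: real
  proof -
    \<comment> \<open>Where truncated subtraction alters an exponent, for n = 1 or n = 2, the factor
      in front is zero.\<close>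
    consider "n = 1" | "n = 2" | m where "n = Suc (Suc (Suc m))"
      using assms(2) by (metis One_nat_def not0_implies_Suc not_one_le_zero numeral_2_eq_2)
    note c = this
    show "(real n - 1) * p ^ (n - 2) * p = (real n - 1) * p ^ (n - 1)"
      "real n * p ^ (n - 1) * p = real n * p ^ n"
      "real (n - 2) * p ^ (n - 3) * p = real (n - 2) * p ^ (n - 2)"
      "real (n - 1) = real n - 1" "(real n - 1) * real (n - 2) = (real n - 1) * (real n - 2)"
      by (cases rule: c; simp add: numeral_2_eq_2 numeral_3_eq_3 One_nat_def algebra_simps)+
  qed
  have "prolongation 3 (v3 n) (equation n) p = - (real n + 1) * equation n p" if "base p \<in> S" for p
  proof -
    let ?u = "p (Du 0 0)"
    \<comment> \<open>Products with \<open>?u\<close> stay unmerged so that \<open>pow\<close> can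
      absorb them uniformly in \<open>n\<close>.\<close>
    have "prolongation 3 (v3 n) (equation n) p = - (real n + 1) * (p (Du 1 0) - p (Du 1 2))
      - (real n + 1) * (real n + 2) / 2 * ((real n * ?u ^ (n - 1) * ?u + ?u ^ n) * p (Du 0 1))
      + real n / 2 * ((real n - 1) * (real (n - 2) * ?u ^ (n - 3) * ?u)
          + 3 * (real n - 1) * ?u ^ (n - 2)) * p (Du 0 1) ^ 3
      + 2 * real n * ((real n - 1) * ?u ^ (n - 2) * ?u + 2 * ?u ^ (n - 1)) * p (Du 0 1) * p (Du 0 2)
      + (real n * ?u ^ (n - 1) * ?u + ?u ^ n) * p (Du 0 3)"
      using that
      by (simp add: prolongation_equation prol_coeff_00 prol_coeff_10 prol_coeff_01 prol_coeff_02
          prol_coeff_03 prol_coeff_12 total_derivative_defs D base_def pow(4) del: prol_coeff.simps)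
        (simp add: field_simps power2_eq_square power3_eq_cube)
    also have "\<dots> = - (real n + 1) * equation n p"
      unfolding pow(1-3) mult.assoc[symmetric] pow(4,5) equation_def Let_def
      by (simp add: field_simps)
    finally show ?thesis .
  qed
  moreover have "smooth_on S (v3 n)"
    unfolding v3 by (intro smooth_on_bounded_linear bounded_linear_Pair L bounded_linear_zero)
  ultimately show ?thesis by (simp add: lie_point_symmetry_generator_def)
qed

theorem theorem2p2:
  fixes n :: nat and S :: "(real \<times> real \<times> real) set"
  assumes "n \<ge> 1" and "open S" and "connected S"
  shows "(\<forall>v. lie_point_symmetry_generator 3 (equation n) S v \<longrightarrow>
            (\<exists>a b c :: real. \<forall>q\<in>S. v q = a *\<^sub>R v1 q + b *\<^sub>R v2 q + c *\<^sub>R v3 n q))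
         \<and> lie_point_symmetry_generator 3 (equation n) S v1
         \<and> lie_point_symmetry_generator 3 (equation n) S v2
         \<and> lie_point_symmetry_generator 3 (equation n) S (v3 n)"
proof (intro conjI allI impI)
  fix v assume v: "lie_point_symmetry_generator 3 (equation n) S v"
  then have sm: "smooth_on S v" by (simp add: lie_point_symmetry_generator_def)
  \<comment> \<open>The components are the projections of \<open>v\<close>, smooth because
    \<open>fst\<close> and \<open>snd\<close> are bounded linear.\<close>
  interpret equation_symmetry S "\<lambda>q. fst (v q)" "\<lambda>q. fst (snd (v q))" "\<lambda>q. snd (snd (v q))" v n
    using v assms(1,2) unfolding lie_point_symmetry_generator_def
    by unfold_locales
      (auto intro: smooth_on_bounded_linear_compose[OF bounded_linear_fst]
        smooth_on_bounded_linear_compose[OF bounded_linear_snd])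
  show "\<exists>a b c. \<forall>q\<in>S. v q = a *\<^sub>R v1 q + b *\<^sub>R v2 q + c *\<^sub>R v3 n q"
    by (rule symmetry_generator_classification[OF assms(3)])
qed (use assms translation_t_symmetry translation_x_symmetry scaling_symmetry in auto)

end
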